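(* Let $n\ge 3$, $k\ge 1$, and let $P_1,\dots,P_k$ be tangential hyperbolic $n$-gons with given total inradius $\sum_{i=1}^k r(P_i)=T$. Then $$\sum_{i=1}^k \mathrm{Peri}(P_i)\;\geq\; 2nk\,\tanh^{-1}\!\left(\tan(\pi/n)\,\sinh(T/k)\right),$$ with equality if and only if all $P_i$ are isometric to a regular $n$-gon of inradius $T/k$.
   Context: A hyperbolic $n$-gon is a polygon with $n$ geodesic sides in the hyperbolic plane of constant curvature $-1$; all of its vertices are assumed to lie in the hyperbolic plane (no ideal vertices). A polygon is tangential if all its sides are tangent to the same circle (its incircle); $r(P)$ denotes the (hyperbolic) radius of the incircle. $\mathrm{Peri}(P)$ is the sum of the hyperbolic lengths of the sides. A polygon is regular if all its sides are equal and all its interior angles are equal. *)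

theory Defs
  imports "HOL-Analysis.Analysis"
begin

text \<open>
  The hyperbolic plane of curvature \<open>-1\<close> is the Poincare disc: the open unit disc of the complex
  plane with the metric \<open>2 |dz| / (1 - |z|^2)\<close>, whose distance function is \<open>hdist\<close>.
\<close>

abbreviation hplane :: "complex set" where
  "hplane \<equiv> ball 0 1"

text \<open>
  The disc automorphism taking \<open>a\<close> to \<open>0\<close>. Its derivative at \<open>a\<close> is a positive real, so
  \<open>to_origin a z\<close> points in the initial direction of the geodesic from \<open>a\<close> to \<open>z\<close>.
\<close>

definition to_origin :: "complex \<Rightarrow> complex \<Rightarrow> complex" where
  "to_origin a z = (z - a) / (1 - cnj a * z)"

definition hdist :: "complex \<Rightarrow> complex \<Rightarrow> real" where
  "hdist z w = 2 * artanh (cmod (to_origin z w))"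

definition hsegment :: "complex \<Rightarrow> complex \<Rightarrow> complex set" where
  "hsegment z w = {u \<in> hplane. hdist z u + hdist u w = hdist z w}"

text \<open>The complete geodesic through \<open>z\<close> and \<open>w\<close>, for distinct \<open>z\<close> and \<open>w\<close>.\<close>

definition hline :: "complex \<Rightarrow> complex \<Rightarrow> complex set" where
  "hline z w = {u \<in> hplane. u \<in> hsegment z w \<or> w \<in> hsegment z u \<or> z \<in> hsegment u w}"

definition hcircle :: "complex \<Rightarrow> real \<Rightarrow> complex set" where
  "hcircle c r = {u \<in> hplane. hdist c u = r}"

definition hisometry :: "(complex \<Rightarrow> complex) \<Rightarrow> bool" where
  "hisometry f \<longleftrightarrow> bij_betw f hplane hplane \<and>
     (\<forall>z\<in>hplane. \<forall>w\<in>hplane. hdist (f z) (f w) = hdist z w)"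

text \<open>A polygon is the list of its vertices in cyclic order; vertex indices are read modulo \<open>n\<close>.\<close>

definition vertex :: "complex list \<Rightarrow> nat \<Rightarrow> complex" where
  "vertex xs j = xs ! (j mod length xs)"

definition side :: "complex list \<Rightarrow> nat \<Rightarrow> complex set" where
  "side xs j = hsegment (vertex xs j) (vertex xs (Suc j))"

definition sides :: "complex list \<Rightarrow> complex set set" where
  "sides xs = side xs ` {..<length xs}"

text \<open>
  The boundary is a simple closed curve (two sides meet at most in a common end point), and
  consecutive sides do not lie on one geodesic, so that there really are \<open>n\<close> sides.
  Polygons need not be convex.
\<close>

definition hpolygon :: "nat \<Rightarrow> complex list \<Rightarrow> bool" where
  "hpolygon n xs \<longleftrightarrow> n \<ge> 3 \<and> length xs = n \<and> set xs \<subseteq> hplane \<and> distinct xs \<and>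
     (\<forall>j<n. vertex xs (Suc (Suc j)) \<notin> hline (vertex xs j) (vertex xs (Suc j))) \<and>
     (\<forall>i<n. \<forall>j<n. i \<noteq> j \<longrightarrow>
        side xs i \<inter> side xs j \<subseteq>
          {vertex xs i, vertex xs (Suc i)} \<inter> {vertex xs j, vertex xs (Suc j)})"

definition perimeter :: "complex list \<Rightarrow> real" where
  "perimeter xs = (\<Sum>j<length xs. hdist (vertex xs j) (vertex xs (Suc j)))"

text \<open>
  A side is tangent to a circle if its geodesic meets the circle in exactly one point and this
  point lies on the side itself, not merely on its extension.
\<close>

definition side_tangent :: "complex list \<Rightarrow> nat \<Rightarrow> complex \<Rightarrow> real \<Rightarrow> bool" where
  "side_tangent xs j c r \<longleftrightarrow>
     (\<exists>t\<in>side xs j. hline (vertex xs j) (vertex xs (Suc j)) \<inter> hcircle c r = {t})"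

text \<open>The polygon is tangential, and its incircle has radius \<open>r\<close>.\<close>

definition tangential_with_inradius :: "complex list \<Rightarrow> real \<Rightarrow> bool" where
  "tangential_with_inradius xs r \<longleftrightarrow>
     r > 0 \<and> (\<exists>c\<in>hplane. \<forall>j<length xs. side_tangent xs j c r)"

text \<open>
  The angle in \<open>[0, 2 pi)\<close> at the vertex with index \<open>Suc j\<close>, measured on the left of the boundary
  traversed in list order, i.e. counterclockwise from the outgoing side to the incoming one.
  The disc model is conformal, so Euclidean angles are hyperbolic angles.
\<close>

definition left_angle :: "complex list \<Rightarrow> nat \<Rightarrow> real" where
  "left_angle xs j =
     Arg2pi (to_origin (vertex xs (Suc j)) (vertex xs j) /
             to_origin (vertex xs (Suc j)) (vertex xs (Suc (Suc j))))"

text \<open>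
  The interior of a simple polygon lies on the same side of the boundary everywhere. By
  Gauss-Bonnet the interior angles sum to \<open>(n - 2) pi\<close> minus the area, so the left angles are the
  interior ones iff they sum to less than \<open>n pi\<close>; otherwise they are the complements to \<open>2 pi\<close>.
\<close>

definition interior_angle :: "complex list \<Rightarrow> nat \<Rightarrow> real" where
  "interior_angle xs j =
     (if (\<Sum>i<length xs. left_angle xs i) < real (length xs) * pi
      then left_angle xs j else 2 * pi - left_angle xs j)"

definition regular_polygon :: "nat \<Rightarrow> complex list \<Rightarrow> bool" where
  "regular_polygon n xs \<longleftrightarrow> hpolygon n xs \<and>
     (\<forall>i<n. \<forall>j<n. hdist (vertex xs i) (vertex xs (Suc i)) = hdist (vertex xs j) (vertex xs (Suc j))) \<and>
     (\<forall>i<n. \<forall>j<n. interior_angle xs i = interior_angle xs j)"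

text \<open>Isometric as polygons, irrespective of the labelling of the vertices.\<close>

definition isometric_polygons :: "complex list \<Rightarrow> complex list \<Rightarrow> bool" where
  "isometric_polygons xs ys \<longleftrightarrow> (\<exists>f. hisometry f \<and> image f ` sides xs = sides ys)"

end

theory Submission
  imports Defs
begin

text \<open>The domain \<open>sinh r * tan \<alpha> < 1\<close> lies below the graph of arctan (1 /
  sinh r), which is strictly convex in r, so averages of admissible pairs may leave it; its slices
  in either variable are intervals. Between the two Jensen steps one therefore has to know that the
  pair (r, pi / n) is admissible: some \<alpha> is at least pi / n, and its slice contains
  everything smaller. Jensen is used in tangent-line form, because a tangent of nonnegative slope
  also covers a sum m pi above pi. The half-angles come from the Klein model with the centre at 0,
  where a tangent side is a chord perpendicular to the radius of its contact point. Isometry of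
  polygons is stated for unlabelled sets of sides, so the converse has to recover lengths from
  segments as sets.\<close>

text \<open>
  Join the centre of the incircle to the vertices and the contact points. If \<open>2 \<alpha>\<^sub>j\<close> is the angle at the
  centre between the contact points of the sides meeting at the \<open>j\<close>-th vertex, then hyperbolic
  trigonometry gives the perimeter as \<open>2 \<Sum> artanh (sinh r * tan \<alpha>\<^sub>j)\<close>, where \<open>\<Sum> \<alpha>\<^sub>j = m pi\<close> for the
  winding number \<open>m \<ge> 1\<close> of the boundary around the centre. The function
  \<open>(r, \<alpha>) \<mapsto> artanh (sinh r * tan \<alpha>)\<close> is strictly convex and increasing in each variable, but its domain
  is not convex. So Jensen's inequality is first applied in \<open>\<alpha>\<close> for each polygon and then in \<open>r\<close> at
  \<open>\<alpha> = pi / n\<close>. Simplicity of the boundary (\<open>m = 1\<close>) is needed only to compute the perimeter of a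
  regular polygon in the converse of the equality case.
\<close>

section \<open>Convexity of the tangent length\<close>

lemma tanh_artanh_real:
  fixes x :: real
  assumes "\<bar>x\<bar> < 1"
  shows "tanh (artanh x) = x"
proof -
  have "exp (- 2 * artanh x) = (1 - x) / (1 + x)"
    using assms by (simp add: artanh_def exp_minus exp_ln)
  then show ?thesis
    using assms unfolding tanh_real_altdef by (simp only:) (simp add: field_simps)
qed

lemma artanh_real_nonneg: "0 \<le> x \<Longrightarrow> x < 1 \<Longrightarrow> 0 \<le> artanh (x::real)"
  by (metis tanh_artanh_real tanh_real_nonneg_iff abs_of_nonneg)

lemma artanh_real_inj: "\<bar>x\<bar> < 1 \<Longrightarrow> \<bar>y\<bar> < 1 \<Longrightarrow> artanh (x::real) = artanh y \<Longrightarrow> x = y"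
  by (metis tanh_artanh_real)

lemma strictly_above_tangent:
  fixes f f' :: "real \<Rightarrow> real"
  assumes der: "\<And>x. a < x \<Longrightarrow> x < b \<Longrightarrow> (f has_real_derivative f' x) (at x)"
    and mono: "\<And>x y. a < x \<Longrightarrow> x < y \<Longrightarrow> y < b \<Longrightarrow> f' x < f' y"
    and c: "a < c" "c < b" and x: "a < x" "x < b" and "x \<noteq> c"
  shows "f x > f c + f' c * (x - c)"
proof (cases "x < c")
  case True
  then obtain z where z: "x < z" "z < c" "f c - f x = (c - x) * f' z"
    using MVT2[OF True, of f f'] der c x by force
  have "(c - x) * f' z < (c - x) * f' c"
    using z True mono[of z c] c x by simp
  then show ?thesis using z by (simp add: algebra_simps)
next
  case False
  with \<open>x \<noteq> c\<close> have cx: "c < x" by simp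
  then obtain z where z: "c < z" "z < x" "f x - f c = (x - c) * f' z"
    using MVT2[OF cx, of f f'] der c x by force
  have "(x - c) * f' c < (x - c) * f' z"
    using z cx mono[of c z] c x by simp
  then show ?thesis using z by (simp add: algebra_simps)
qed

text \<open>Sum \<open>strictly_above_tangent\<close> at c. The linear term is the slope times the
  excess of the sum over its required value, so with a nonnegative slope a lower bound on the mean
  suffices. In the equality case every gap \<open>g i\<close> vanishes, and gaps are positive away
  from c.\<close>

lemma jensen_tangent:
  fixes f f' :: "real \<Rightarrow> real"
  assumes der: "\<And>x. a < x \<Longrightarrow> x < b \<Longrightarrow> (f has_real_derivative f' x) (at x)"
    and mono: "\<And>x y. a < x \<Longrightarrow> x < y \<Longrightarrow> y < b \<Longrightarrow> f' x < f' y"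
    and c: "a < c" "c < b" "0 \<le> f' c"
    and I: "finite I" "\<And>i. i \<in> I \<Longrightarrow> a < x i \<and> x i < b"
    and mean: "real (card I) * c \<le> (\<Sum>i\<in>I. x i)"
  shows "real (card I) * f c \<le> (\<Sum>i\<in>I. f (x i))"
    and "(\<Sum>i\<in>I. f (x i)) = real (card I) * f c \<Longrightarrow> i \<in> I \<Longrightarrow> x i = c"
proof -
  define g where "g i = f (x i) - (f c + f' c * (x i - c))" for i
  have gpos: "0 < g i" if "i \<in> I" "x i \<noteq> c" for i
    using strictly_above_tangent[of a b f f' c "x i"] der mono c I that unfolding g_def by force
  then have gnn: "0 \<le> g i" if "i \<in> I" for i
    using that by (cases "x i = c") (force simp: g_def)+
  have eq: "(\<Sum>i\<in>I. f (x i))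
      = real (card I) * f c + f' c * ((\<Sum>i\<in>I. x i) - real (card I) * c) + (\<Sum>i\<in>I. g i)"
    unfolding g_def by (simp add: sum.distrib sum_subtractf sum_distrib_left[symmetric] algebra_simps)
  have nn: "0 \<le> f' c * ((\<Sum>i\<in>I. x i) - real (card I) * c)"
    using c mean by simp
  have gs: "0 \<le> (\<Sum>i\<in>I. g i)" using gnn by (rule sum_nonneg)
  show "real (card I) * f c \<le> (\<Sum>i\<in>I. f (x i))"
    using eq nn gs by linarith
  assume e: "(\<Sum>i\<in>I. f (x i)) = real (card I) * f c" and i: "i \<in> I"
  then have "(\<Sum>i\<in>I. g i) = 0" using eq nn gs by linarith
  then have "g i = 0" using sum_nonneg_eq_0_iff[OF I(1), of g] gnn i by blast
  then show "x i = c" using gpos[OF i] by force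
qed

lemma tan_mult_less_one_iff:
  assumes "0 < s" "0 < x" "x < pi / 2"
  shows "s * tan x < 1 \<longleftrightarrow> x < arctan (1 / s)"
proof -
  have "s * tan x < 1 \<longleftrightarrow> tan x < 1 / s" using assms by (simp add: field_simps)
  also have "\<dots> \<longleftrightarrow> arctan (tan x) < arctan (1 / s)" by (simp add: arctan_less_iff)
  finally show ?thesis using assms by (simp add: arctan_tan)
qed

lemma sum_artanh_tan:
  fixes \<alpha> :: "'i \<Rightarrow> real"
  assumes s: "0 < s" and I: "finite I" "card I = n" "n \<ge> 3"
    and \<alpha>: "\<And>j. j \<in> I \<Longrightarrow> 0 < \<alpha> j \<and> \<alpha> j < pi / 2 \<and> s * tan (\<alpha> j) < 1"
    and total: "pi \<le> (\<Sum>j\<in>I. \<alpha> j)"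
  shows "s * tan (pi / real n) < 1"
    and "real n * artanh (s * tan (pi / real n)) \<le> (\<Sum>j\<in>I. artanh (s * tan (\<alpha> j)))"
    and "(\<Sum>j\<in>I. artanh (s * tan (\<alpha> j))) = real n * artanh (s * tan (pi / real n)) \<Longrightarrow>
           j \<in> I \<Longrightarrow> \<alpha> j = pi / real n"
proof -
  define b where "b = arctan (1 / s)"
  \<comment> \<open>The derivative of \<open>artanh (s * tan x)\<close> with the squared cosine
    multiplied into the denominator: it increases because this denominator decreases.\<close>
  define f' where "f' x = s / ((cos x)\<^sup>2 - s\<^sup>2 * (sin x)\<^sup>2)" for x
  have b: "0 < b" "b < pi / 2" using s arctan_ubound[of "1 / s"] by (auto simp: b_def)
  have \<alpha>b: "\<alpha> j < b" if "j \<in> I" for j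
    using \<alpha>[OF that] tan_mult_less_one_iff[OF s, of "\<alpha> j"] by (simp add: b_def)
  have c: "0 < pi / real n" using I by simp
  \<comment> \<open>This angle is below \<open>b\<close>, hence so is pi / n: the mean lies in the
    domain.\<close>
  have "\<exists>j\<in>I. pi / real n \<le> \<alpha> j"
  proof (rule ccontr)
    assume "\<not> ?thesis"
    then have "(\<Sum>j\<in>I. \<alpha> j) < (\<Sum>j\<in>I. pi / real n)"
      using I by (intro sum_strict_mono) (auto simp: not_le)
    also have "\<dots> = pi" using I by simp
    finally show False using total by simp
  qed
  then have cb: "pi / real n < b" using \<alpha>b by fastforce
  show lt: "s * tan (pi / real n) < 1"
    using tan_mult_less_one_iff[OF s c] cb b unfolding b_def by linarith
  have dom: "0 < cos x \<and> 0 < sin x \<and> s * tan x < 1 \<and> 0 < (cos x)\<^sup>2 - s\<^sup>2 * (sin x)\<^sup>2 \<and> 0 < s * tan x"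
    if "0 < x" "x < b" for x
  proof -
    have cs: "0 < cos x" "0 < sin x"
      using that b by (auto intro!: cos_gt_zero sin_gt_zero)
    have "s * tan x < 1"
      using tan_mult_less_one_iff[OF s, of x] that b by (simp add: b_def)
    then have "s * sin x < cos x" using cs by (simp add: tan_def field_simps)
    then have "(s * sin x)\<^sup>2 < (cos x)\<^sup>2"
      using cs s by (intro power_strict_mono) auto
    then show ?thesis using cs s \<open>s * tan x < 1\<close> by (auto simp: power_mult_distrib tan_def)
  qed
  have der: "((\<lambda>x. artanh (s * tan x)) has_real_derivative f' x) (at x)" if x: "0 < x" "x < b" for x
  proof -
    have "((\<lambda>x. artanh (s * tan x)) has_real_derivative
        (1 / (1 - (s * tan x)\<^sup>2)) * (s * inverse ((cos x)\<^sup>2))) (at x)"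
      using dom[OF x]
      by (intro DERIV_chain2[OF artanh_real_has_field_derivative]) (auto intro!: derivative_eq_intros)
    also have "(1 / (1 - (s * tan x)\<^sup>2)) * (s * inverse ((cos x)\<^sup>2)) = f' x"
    proof -
      have "1 - (s * tan x)\<^sup>2 = ((cos x)\<^sup>2 - s\<^sup>2 * (sin x)\<^sup>2) / (cos x)\<^sup>2"
        using dom[OF x] by (simp add: tan_def field_simps power2_eq_square)
      then show ?thesis using dom[OF x] by (simp add: f'_def field_simps)
    qed
    finally show ?thesis .
  qed
  have mono: "f' x < f' y" if "0 < x" "x < y" "y < b" for x y
  proof -
    have "cos y < cos x" using that b by (intro cos_monotone_0_pi) auto
    then have 1: "(cos y)\<^sup>2 < (cos x)\<^sup>2" using dom[of y] that by (intro power_strict_mono) auto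
    then have "(sin x)\<^sup>2 \<le> (sin y)\<^sup>2" by (simp add: sin_squared_eq)
    then have "s\<^sup>2 * (sin x)\<^sup>2 \<le> s\<^sup>2 * (sin y)\<^sup>2" by (simp add: mult_left_mono)
    then have "(cos y)\<^sup>2 - s\<^sup>2 * (sin y)\<^sup>2 < (cos x)\<^sup>2 - s\<^sup>2 * (sin x)\<^sup>2" using 1 by linarith
    then show ?thesis unfolding f'_def
      using dom[of y] dom[of x] that s by (intro divide_strict_left_mono) auto
  qed
  have fc: "0 \<le> f' (pi / real n)"
    using dom[OF c cb] s by (simp add: f'_def)
  have mean: "real (card I) * (pi / real n) \<le> (\<Sum>j\<in>I. \<alpha> j)"
    using I total by simp
  have range: "0 < \<alpha> j \<and> \<alpha> j < b" if "j \<in> I" for j using \<alpha> \<alpha>b that by blast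
  note J = jensen_tangent[where f = "\<lambda>x. artanh (s * tan x)" and f' = f' and a = 0 and b = b
      and c = "pi / real n" and I = I and x = \<alpha>, OF der mono c cb fc I(1) range mean]
  show "real n * artanh (s * tan (pi / real n)) \<le> (\<Sum>j\<in>I. artanh (s * tan (\<alpha> j)))"
    using J(1) I(2) by simp
  show "(\<Sum>j\<in>I. artanh (s * tan (\<alpha> j))) = real n * artanh (s * tan (pi / real n)) \<Longrightarrow>
           j \<in> I \<Longrightarrow> \<alpha> j = pi / real n"
    using J(2)[of j] I(2) by simp
qed

text \<open>Applied with t = tan (pi / n). The numerator of \<open>f'\<close> grows and its
  denominator decreases; the domain is the interval below \<open>arsinh (1 / t)\<close>, so it
  contains the mean of the radii.\<close>

lemma sum_artanh_sinh:
  fixes r :: "nat \<Rightarrow> real"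
  assumes t: "0 < t" and k: "k \<ge> 1"
    and r: "\<And>i. i < k \<Longrightarrow> 0 < r i \<and> t * sinh (r i) < 1"
    and T: "(\<Sum>i<k. r i) = T"
  shows "real k * artanh (t * sinh (T / real k)) \<le> (\<Sum>i<k. artanh (t * sinh (r i)))"
    and "(\<Sum>i<k. artanh (t * sinh (r i))) = real k * artanh (t * sinh (T / real k)) \<Longrightarrow>
           i < k \<Longrightarrow> r i = T / real k"
proof -
  define b where "b = arsinh (1 / t)"
  define f' where "f' x = t * cosh x / (1 - (t * sinh x)\<^sup>2)" for x
  have iff: "t * sinh x < 1 \<longleftrightarrow> x < b" for x
  proof -
    have "t * sinh x < 1 \<longleftrightarrow> sinh x < sinh b" using t by (simp add: b_def field_simps)
    then show ?thesis by (simp add: sinh_real_less_iff)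
  qed
  have ne: "{..<k} \<noteq> {}" using k by (simp add: lessThan_empty_iff)
  have "0 < T" unfolding T[symmetric] using r ne by (intro sum_pos) auto
  then have c: "0 < T / real k" using k by simp
  have "T < (\<Sum>i<k. b)" unfolding T[symmetric] using r iff ne by (intro sum_strict_mono) auto
  then have cb: "T / real k < b" using k by (simp add: field_simps)
  have dom: "0 < sinh x \<and> t * sinh x < 1 \<and> 0 < t * sinh x \<and> 0 < 1 - (t * sinh x)\<^sup>2" if "0 < x" "x < b" for x
  proof -
    have "t * sinh x < 1" "0 < t * sinh x" using that iff t by auto
    then have "(t * sinh x)\<^sup>2 < 1" by (simp add: abs_square_less_1)
    then show ?thesis using that \<open>t * sinh x < 1\<close> t by auto
  qed
  have der: "((\<lambda>x. artanh (t * sinh x)) has_real_derivative f' x) (at x)" if x: "0 < x" "x < b" for x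
  proof -
    have "((\<lambda>x. artanh (t * sinh x)) has_real_derivative
        (1 / (1 - (t * sinh x)\<^sup>2)) * (t * cosh x)) (at x)"
      using dom[OF x]
      by (intro DERIV_chain2[OF artanh_real_has_field_derivative]) (auto intro!: derivative_eq_intros)
    then show ?thesis by (simp add: f'_def)
  qed
  have mono: "f' x < f' y" if "0 < x" "x < y" "y < b" for x y
  proof -
    have 1: "cosh x < cosh y" using that by (simp add: cosh_real_nonneg_less_iff)
    have "(t * sinh x)\<^sup>2 \<le> (t * sinh y)\<^sup>2"
      using that t dom[of x] by (intro power_mono) auto
    then show ?thesis unfolding f'_def
      using 1 dom[of y] dom[of x] that t by (intro frac_less) auto
  qed
  have fc: "0 \<le> f' (T / real k)" using dom[OF c cb] t by (simp add: f'_def)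
  have mean: "real (card {..<k}) * (T / real k) \<le> (\<Sum>i<k. r i)" using k T by simp
  have range: "0 < r i \<and> r i < b" if "i \<in> {..<k}" for i using r iff that by auto
  note J = jensen_tangent[where f = "\<lambda>x. artanh (t * sinh x)" and f' = f' and a = 0 and b = b
      and c = "T / real k" and I = "{..<k}" and x = r, OF der mono c cb fc finite_lessThan range mean]
  show "real k * artanh (t * sinh (T / real k)) \<le> (\<Sum>i<k. artanh (t * sinh (r i)))"
    using J(1) by simp
  show "(\<Sum>i<k. artanh (t * sinh (r i))) = real k * artanh (t * sinh (T / real k)) \<Longrightarrow>
           i < k \<Longrightarrow> r i = T / real k"
    using J(2)[of i] by simp
qed

section \<open>Isometries of the Poincare disc\<close>

lemma cmod_to_origin_sq:
  assumes "cmod a < 1" "cmod z < 1"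
  shows "1 - (cmod (to_origin a z))\<^sup>2
    = (1 - (cmod a)\<^sup>2) * (1 - (cmod z)\<^sup>2) / (cmod (1 - cnj a * z))\<^sup>2"
    and "1 - cnj a * z \<noteq> 0"
proof -
  have "cmod (cnj a * z) < 1 * 1" unfolding norm_mult complex_mod_cnj
    using assms by (intro mult_strict_mono') auto
  then show ne: "1 - cnj a * z \<noteq> 0" by auto
  have "(cmod (1 - cnj a * z))\<^sup>2 - (cmod (z - a))\<^sup>2 = (1 - (cmod a)\<^sup>2) * (1 - (cmod z)\<^sup>2)"
    unfolding cmod_power2 by (simp add: algebra_simps power2_eq_square)
  then show "1 - (cmod (to_origin a z))\<^sup>2
    = (1 - (cmod a)\<^sup>2) * (1 - (cmod z)\<^sup>2) / (cmod (1 - cnj a * z))\<^sup>2"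
    using ne by (simp add: to_origin_def norm_divide power_divide field_simps)
qed

lemma one_minus_cmod_sq_pos: "cmod z < 1 \<Longrightarrow> 0 < 1 - (cmod z)\<^sup>2"
  by (simp add: abs_square_less_1)

lemma cmod_to_origin_less:
  assumes "cmod a < 1" "cmod z < 1"
  shows "cmod (to_origin a z) < 1"
proof -
  have "0 < 1 - (cmod (to_origin a z))\<^sup>2"
    using cmod_to_origin_sq[OF assms] one_minus_cmod_sq_pos[OF assms(1)]
      one_minus_cmod_sq_pos[OF assms(2)] by simp
  then show ?thesis by (simp add: abs_square_less_1)
qed

lemma to_origin_inverse:
  assumes "cmod a < 1" "cmod z < 1"
  shows "to_origin (- a) (to_origin a z) = z"
proof -
  have ne: "1 - cnj a * z \<noteq> 0" "1 - cnj a * a \<noteq> 0"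
    using cmod_to_origin_sq(2) assms by blast+
  have "to_origin a z + a = z * (1 - cnj a * a) / (1 - cnj a * z)"
    "1 + cnj a * to_origin a z = (1 - cnj a * a) / (1 - cnj a * z)"
    using ne by (simp_all add: to_origin_def field_simps)
  then show ?thesis
    using ne by (simp add: to_origin_def[of "- a"])
qed

text \<open>Two disc automorphisms sending a to 0 differ by a rotation. The factor is a quotient of
  conjugate numbers, hence unimodular, and does not depend on z; so distances and quotients of
  directions at a are preserved.\<close>

lemma to_origin_to_origin:
  assumes "cmod c < 1" "cmod a < 1" "cmod z < 1"
  shows "to_origin (to_origin c a) (to_origin c z)
    = (1 - c * cnj a) / (1 - cnj c * a) * to_origin a z"
proof -
  have ne: "1 - cnj c * a \<noteq> 0" "1 - cnj c * z \<noteq> 0" "1 - cnj a * z \<noteq> 0" "1 - c * cnj a \<noteq> 0" "1 - cnj c * c \<noteq> 0"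
    using cmod_to_origin_sq(2) assms by (metis mult.commute)+
  have 1: "to_origin c z - to_origin c a = (z - a) * (1 - cnj c * c) / ((1 - cnj c * z) * (1 - cnj c * a))"
    using ne unfolding to_origin_def by (simp add: divide_simps) (simp add: algebra_simps)
  have 2: "1 - cnj (to_origin c a) * to_origin c z
      = (1 - cnj a * z) * (1 - cnj c * c) / ((1 - c * cnj a) * (1 - cnj c * z))"
    using ne unfolding to_origin_def by (simp add: divide_simps) (simp add: algebra_simps)
  show ?thesis
    unfolding to_origin_def[of "to_origin c a"] 1 2 unfolding to_origin_def[of a z]
    using ne by (simp add: divide_simps)
qed

lemma hisometry_hdist: "hisometry f \<Longrightarrow> cmod z < 1 \<Longrightarrow> cmod w < 1 \<Longrightarrow> hdist (f z) (f w) = hdist z w"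
  by (simp add: hisometry_def)

lemma hisometry_hplane: "hisometry f \<Longrightarrow> cmod z < 1 \<Longrightarrow> cmod (f z) < 1"
  by (auto simp: hisometry_def bij_betw_def)

lemma hisometry_to_origin:
  assumes c: "cmod c < 1"
  shows "hisometry (to_origin c)"
  unfolding hisometry_def
proof safe
  show "bij_betw (to_origin c) hplane hplane"
    using c to_origin_inverse[of c] to_origin_inverse[of "- c"]
    by (intro bij_betw_byWitness[where f' = "to_origin (- c)"]) (auto simp: cmod_to_origin_less)
  fix z w :: complex assume "z \<in> hplane" "w \<in> hplane"
  moreover have "cmod ((1 - c * cnj z) / (1 - cnj c * z)) = 1" if "cmod z < 1"
  proof -
    have "1 - c * cnj z = cnj (1 - cnj c * z)" by simp
    then have "cmod (1 - c * cnj z) = cmod (1 - cnj c * z)" by (metis complex_mod_cnj)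
    then show ?thesis using cmod_to_origin_sq(2)[OF c that] by (simp add: norm_divide)
  qed
  ultimately show "hdist (to_origin c z) (to_origin c w) = hdist z w"
    unfolding hdist_def by (simp only: to_origin_to_origin[OF c] norm_mult mem_ball_0 mult_1_left)
qed

lemma to_origin_rotation: "cmod u = 1 \<Longrightarrow> to_origin (u * a) (u * z) = u * to_origin a z"
proof -
  assume "cmod u = 1"
  then have "cnj u * u = 1" using complex_norm_square[of u] by (simp add: mult.commute)
  then have "cnj (u * a) * (u * z) = cnj a * z"
    by (metis (no_types, opaque_lifting) complex_cnj_mult mult.assoc mult.commute mult.left_neutral)
  then show ?thesis unfolding to_origin_def by (simp add: algebra_simps)
qed

lemma hisometry_rotation:
  assumes "cmod u = 1"
  shows "hisometry (\<lambda>z. u * z)"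
  unfolding hisometry_def
proof safe
  have "u \<noteq> 0" using assms by auto
  then show "bij_betw (\<lambda>z. u * z) hplane hplane"
    using assms by (intro bij_betw_byWitness[where f' = "\<lambda>z. z / u"]) (auto simp: norm_mult norm_divide)
qed (simp add: hdist_def to_origin_rotation assms norm_mult)

text \<open>Reverses the orientation of clockwise polygons in
  \<open>regular_normal_form\<close>.\<close>

lemma hisometry_cnj: "hisometry cnj"
  unfolding hisometry_def
proof safe
  show "bij_betw cnj hplane hplane"
    by (intro bij_betw_byWitness[where f' = cnj]) auto
  fix z w
  have "to_origin (cnj z) (cnj w) = cnj (to_origin z w)" by (simp add: to_origin_def)
  then show "hdist (cnj z) (cnj w) = hdist z w" by (simp add: hdist_def)
qed

lemma hisometry_compose: "hisometry f \<Longrightarrow> hisometry g \<Longrightarrow> hisometry (g \<circ> f)"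
  unfolding hisometry_def by (auto intro: bij_betw_trans dest: bij_betwE)

lemma hisometry_inv:
  assumes "hisometry f"
  shows "hisometry (inv_into hplane f)"
proof -
  have b: "bij_betw f hplane hplane" using assms by (simp add: hisometry_def)
  have "inv_into hplane f z \<in> hplane \<and> f (inv_into hplane f z) = z" if "z \<in> hplane" for z
    using b that by (metis bij_betw_def f_inv_into_f inv_into_into)
  then show ?thesis
    using assms bij_betw_inv_into[OF b] unfolding hisometry_def by metis
qed

lemma hisometry_hsegment:
  assumes f: "hisometry f" and "cmod z < 1" "cmod w < 1"
  shows "f ` hsegment z w = hsegment (f z) (f w)"
proof (intro equalityI subsetI)
  fix x assume "x \<in> f ` hsegment z w"
  then show "x \<in> hsegment (f z) (f w)"
    using assms hisometry_hdist[OF f] hisometry_hplane[OF f] by (auto simp: hsegment_def)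
next
  fix x assume x: "x \<in> hsegment (f z) (f w)"
  then have "x \<in> f ` hplane" using f by (auto simp: hsegment_def hisometry_def bij_betw_def)
  then show "x \<in> f ` hsegment z w"
    using x assms hisometry_hdist[OF f] by (auto simp: hsegment_def)
qed

lemma hisometry_hline:
  assumes f: "hisometry f" and zw: "cmod z < 1" "cmod w < 1"
  shows "f ` hline z w = hline (f z) (f w)"
proof (intro equalityI subsetI)
  fix x assume "x \<in> f ` hline z w"
  then show "x \<in> hline (f z) (f w)"
    using assms hisometry_hdist[OF f] hisometry_hplane[OF f] by (auto simp: hsegment_def hline_def)
next
  fix x assume x: "x \<in> hline (f z) (f w)"
  then have "x \<in> f ` hplane" using f by (auto simp: hline_def hisometry_def bij_betw_def)
  then show "x \<in> f ` hline z w"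
    using x assms hisometry_hdist[OF f] hisometry_hplane[OF f] by (auto simp: hsegment_def hline_def)
qed

lemma hisometry_hcircle:
  assumes f: "hisometry f" and "cmod c < 1"
  shows "f ` hcircle c r = hcircle (f c) r"
proof (intro equalityI subsetI)
  fix x assume "x \<in> f ` hcircle c r"
  then show "x \<in> hcircle (f c) r"
    using assms hisometry_hdist[OF f] hisometry_hplane[OF f] by (auto simp: hcircle_def)
next
  fix x assume x: "x \<in> hcircle (f c) r"
  then have "x \<in> f ` hplane" using f by (auto simp: hcircle_def hisometry_def bij_betw_def)
  then show "x \<in> f ` hcircle c r"
    using x assms hisometry_hdist[OF f] by (auto simp: hcircle_def)
qed

section \<open>The Klein model\<close>

text \<open>The map to the Klein model, in which the geodesics are the Euclidean chords of the disc.\<close>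

definition klein :: "complex \<Rightarrow> complex" where
  "klein z = of_real (2 / (1 + (cmod z)\<^sup>2)) * z"

text \<open>The modulus is the root t < 1 of 2 t / (1 + t^2) = |x|.\<close>

definition klein_inv :: "complex \<Rightarrow> complex" where
  "klein_inv x = of_real (1 / (1 + sqrt (1 - (cmod x)\<^sup>2))) * x"

lemma one_plus_cmod_sq_pos: "0 < 1 + (cmod z)\<^sup>2"
  by (simp add: add_pos_nonneg)

lemma cmod_klein: "cmod (klein z) = 2 * cmod z / (1 + (cmod z)\<^sup>2)"
  unfolding klein_def norm_mult norm_of_real using one_plus_cmod_sq_pos[of z] by simp

lemma one_minus_cmod_klein_sq: "1 - (cmod (klein z))\<^sup>2 = ((1 - (cmod z)\<^sup>2) / (1 + (cmod z)\<^sup>2))\<^sup>2"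
proof -
  have "(cmod (klein z))\<^sup>2 = 4 * (cmod z)\<^sup>2 / (1 + (cmod z)\<^sup>2)\<^sup>2"
    by (simp add: cmod_klein power_mult_distrib power_divide)
  then show ?thesis
    using one_plus_cmod_sq_pos[of z] by (simp add: power2_eq_square divide_simps) (simp add: algebra_simps)
qed

lemma sqrt_one_minus_cmod_klein_sq:
  "cmod z < 1 \<Longrightarrow> sqrt (1 - (cmod (klein z))\<^sup>2) = (1 - (cmod z)\<^sup>2) / (1 + (cmod z)\<^sup>2)"
  unfolding one_minus_cmod_klein_sq
  using one_minus_cmod_sq_pos[of z] one_plus_cmod_sq_pos[of z] by simp

lemma cmod_klein_less: "cmod z < 1 \<Longrightarrow> cmod (klein z) < 1"
proof -
  assume "cmod z < 1"
  then have "0 < 1 - (cmod (klein z))\<^sup>2"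
    unfolding one_minus_cmod_klein_sq
    using one_minus_cmod_sq_pos[of z] one_plus_cmod_sq_pos[of z] by simp
  then show ?thesis by (simp add: abs_square_less_1)
qed

lemma klein_inv_klein: "cmod z < 1 \<Longrightarrow> klein_inv (klein z) = z"
proof -
  assume z: "cmod z < 1"
  define q where "q = (cmod z)\<^sup>2"
  have q: "0 \<le> q" "q < 1" using z by (auto simp: q_def abs_square_less_1)
  have "1 / (1 + (1 - q) / (1 + q)) * (2 / (1 + q)) = 1" using q by (simp add: field_simps)
  then show ?thesis
    unfolding klein_inv_def sqrt_one_minus_cmod_klein_sq[OF z]
    unfolding klein_def q_def[symmetric] mult.assoc[symmetric] of_real_mult[symmetric] by simp
qed

lemma klein_inj: "cmod z < 1 \<Longrightarrow> cmod w < 1 \<Longrightarrow> klein z = klein w \<Longrightarrow> z = w"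
  by (metis klein_inv_klein)

lemma klein_klein_inv:
  assumes x: "cmod x < 1"
  shows "cmod (klein_inv x) < 1" and "klein (klein_inv x) = x"
proof -
  define c where "c = sqrt (1 - (cmod x)\<^sup>2)"
  have c: "0 < c" "c\<^sup>2 = 1 - (cmod x)\<^sup>2" using one_minus_cmod_sq_pos[OF x] by (auto simp: c_def)
  have m: "cmod (klein_inv x) = cmod x / (1 + c)"
    unfolding klein_inv_def norm_mult norm_of_real c_def[symmetric] using c by simp
  show "cmod (klein_inv x) < 1" unfolding m using c x by (simp add: field_simps)
  have "(cmod (klein_inv x))\<^sup>2 = (1 - c\<^sup>2) / (1 + c)\<^sup>2" unfolding m using c by (simp add: power_divide)
  also have "\<dots> = (1 - c) / (1 + c)" using c by (simp add: power2_eq_square divide_simps) (simp add: algebra_simps)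
  finally have q: "(cmod (klein_inv x))\<^sup>2 = (1 - c) / (1 + c)" .
  have "2 / (1 + (1 - c) / (1 + c)) * (1 / (1 + c)) = 1" using c by (simp add: field_simps)
  then show "klein (klein_inv x) = x"
    unfolding klein_def q unfolding klein_inv_def c_def[symmetric] mult.assoc[symmetric] of_real_mult[symmetric]
    by simp
qed

lemma klein_rotation: "cmod u = 1 \<Longrightarrow> klein (u * z) = u * klein z"
  by (simp add: klein_def norm_mult)

lemma hdist_nonneg: "cmod z < 1 \<Longrightarrow> cmod w < 1 \<Longrightarrow> 0 \<le> hdist z w"
  unfolding hdist_def using artanh_real_nonneg[OF _ cmod_to_origin_less] by simp

text \<open>Distances are nonnegative, so \<open>cosh\<close> loses nothing
  (\<open>hdist_eqI\<close>) and replaces \<open>artanh\<close> by a rational expression.\<close>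

lemma cosh_hdist:
  assumes "cmod z < 1" "cmod w < 1"
  shows "cosh (hdist z w) = 1 + 2 * (cmod (z - w))\<^sup>2 / ((1 - (cmod z)\<^sup>2) * (1 - (cmod w)\<^sup>2))"
proof -
  define d where "d = cmod (to_origin z w)"
  define y where "y = artanh d"
  have d: "0 \<le> d" "d < 1" using cmod_to_origin_less[OF assms] by (auto simp: d_def)
  then have "tanh y = d" by (simp add: y_def tanh_artanh_real)
  then have s: "sinh y = d * cosh y" by (simp add: tanh_def field_simps)
  have "(cosh y)\<^sup>2 - (d * cosh y)\<^sup>2 = 1" using hyperbolic_pythagoras[of y] by (simp add: s)
  then have "(cosh y)\<^sup>2 * (1 - d\<^sup>2) = 1" by (simp add: algebra_simps power_mult_distrib)
  moreover have pos: "0 < 1 - d\<^sup>2" using d by (simp add: abs_square_less_1)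
  ultimately have c: "(cosh y)\<^sup>2 = 1 / (1 - d\<^sup>2)" by (simp add: field_simps)
  have "cosh (hdist z w) = (cosh y)\<^sup>2 + (d * cosh y)\<^sup>2"
    by (simp add: hdist_def d_def[symmetric] y_def[symmetric] cosh_double s)
  also have "\<dots> = 1 + 2 * (d\<^sup>2 / (1 - d\<^sup>2))"
    unfolding power_mult_distrib c using pos by (simp add: field_simps)
  also have "d\<^sup>2 / (1 - d\<^sup>2) = (cmod (z - w))\<^sup>2 / ((1 - (cmod z)\<^sup>2) * (1 - (cmod w)\<^sup>2))"
  proof -
    have "d\<^sup>2 = (cmod (z - w))\<^sup>2 / (cmod (1 - cnj z * w))\<^sup>2"
      by (simp add: d_def to_origin_def norm_divide power_divide norm_minus_commute)
    then show ?thesis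
      using cmod_to_origin_sq[OF assms] by (simp add: d_def[symmetric])
  qed
  finally show ?thesis by simp
qed

text \<open>In the hyperboloid model a point x of the Klein disc is the unit vector (1, x) / sqrt (1
  - |x|^2), and \<open>cosh\<close> of the distance is minus the Lorentz product of two such
  vectors.\<close>

lemma cosh_hdist_klein:
  assumes "cmod z < 1" "cmod w < 1"
  shows "cosh (hdist z w) * (sqrt (1 - (cmod (klein z))\<^sup>2) * sqrt (1 - (cmod (klein w))\<^sup>2))
    = 1 - klein z \<bullet> klein w"
proof -
  define p q where "p = (cmod z)\<^sup>2" and "q = (cmod w)\<^sup>2"
  have pq: "0 < 1 - p" "0 < 1 - q" "0 < 1 + p" "0 < 1 + q"
    using one_minus_cmod_sq_pos assms one_plus_cmod_sq_pos by (auto simp: p_def q_def)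
  have n: "(cmod (z - w))\<^sup>2 = p + q - 2 * (z \<bullet> w)"
    by (simp add: p_def q_def power2_norm_eq_inner inner_diff_left inner_diff_right inner_commute)
  have k: "klein z \<bullet> klein w = 4 * (z \<bullet> w) / ((1 + p) * (1 + q))"
    unfolding klein_def p_def[symmetric] q_def[symmetric]
    by (simp add: scaleR_conv_of_real[symmetric] del: of_real_divide)
  show ?thesis
    unfolding cosh_hdist[OF assms] sqrt_one_minus_cmod_klein_sq[OF assms(1)] sqrt_one_minus_cmod_klein_sq[OF assms(2)]
    unfolding p_def[symmetric] q_def[symmetric] n k
    using pq by (simp add: divide_simps) (simp add: algebra_simps)
qed

lemma hdist_eqI:
  assumes "cmod z < 1" "cmod w < 1" "cmod z' < 1" "cmod w' < 1" "cosh (hdist z w) = cosh (hdist z' w')"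
  shows "hdist z w = hdist z' w'"
  using assms hdist_nonneg[of z w] hdist_nonneg[of z' w'] by simp

lemma hdist_commute: "cmod z < 1 \<Longrightarrow> cmod w < 1 \<Longrightarrow> hdist z w = hdist w z"
  by (rule hdist_eqI) (simp_all add: cosh_hdist norm_minus_commute mult.commute)

text \<open>
  \<open>gform p\<close> is a multiple of the Riemannian metric of the Klein model at \<open>p\<close>. Multiplied by
  suitable positive factors, \<open>cosh a * cosh b - cosh d\<close> and \<open>(sinh a * sinh b)\<^sup>2\<close> for the sides of a
  hyperbolic triangle become \<open>gform p e f\<close> and \<open>gform p e e * gform p f f\<close>, so that
  equality in the triangle inequality is equality in Cauchy-Schwarz.
\<close>

definition gform :: "complex \<Rightarrow> complex \<Rightarrow> complex \<Rightarrow> real" where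
  "gform p e f = (1 - (cmod p)\<^sup>2) * (e \<bullet> f) + (p \<bullet> e) * (p \<bullet> f)"

lemma gform_pos: "cmod p < 1 \<Longrightarrow> e \<noteq> 0 \<Longrightarrow> 0 < gform p e e"
  unfolding gform_def using one_minus_cmod_sq_pos[of p] by (simp add: add_pos_nonneg)

lemma gform_nonneg: "cmod p < 1 \<Longrightarrow> 0 \<le> gform p e e"
  using gform_pos[of p e] by (cases "e = 0") (auto simp: gform_def)

text \<open>The form has eigenvalues 1 and 1 - |p|^2; a Gram determinant is the determinant of the
  form times the squared area spanned by e and f.\<close>

lemma gform_gram:
  "gform p e e * gform p f f - (gform p e f)\<^sup>2 = (1 - (cmod p)\<^sup>2) * (Re e * Im f - Im e * Re f)\<^sup>2"
  unfolding gform_def inner_complex_def cmod_power2 by algebra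

text \<open>Betweenness means that the vectors from p to x and y are antiparallel: equality in
  Cauchy-Schwarz with a nonpositive product.\<close>

lemma gform_closed_segment:
  assumes p: "cmod p < 1"
  shows "p \<in> closed_segment x y \<longleftrightarrow>
     gform p (x - p) (y - p) \<le> 0 \<and> gform p (x - p) (x - p) * gform p (y - p) (y - p) = (gform p (x - p) (y - p))\<^sup>2"
    (is "?L \<longleftrightarrow> ?R")
proof
  assume ?L
  then obtain s where s: "0 \<le> s" "s \<le> 1" "p = (1 - s) *\<^sub>R x + s *\<^sub>R y" by (auto simp: in_segment)
  have e: "x - p = s *\<^sub>R (x - y)" "y - p = (s - 1) *\<^sub>R (x - y)" unfolding s(3) by (simp_all add: algebra_simps)
  have g: "gform p (a *\<^sub>R (x - y)) (b *\<^sub>R (x - y)) = a * b * gform p (x - y) (x - y)" for a b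
    by (simp add: gform_def algebra_simps)
  have "s * (s - 1) \<le> 0" using s by (simp add: mult_nonneg_nonpos)
  then show ?R unfolding e g using gform_nonneg[OF p, of "x - y"]
    by (auto simp: power2_eq_square mult_nonpos_nonneg)
next
  assume R: ?R
  define e f where "e = x - p" and "f = y - p"
  show ?L
  proof (cases "e = 0")
    case True
    then show ?thesis by (simp add: e_def)
  next
    case False
    have "(1 - (cmod p)\<^sup>2) * (Re e * Im f - Im e * Re f)\<^sup>2 = 0"
      using R gform_gram[of p e f] by (simp add: e_def f_def)
    then have cr: "Re e * Im f = Im e * Re f" using one_minus_cmod_sq_pos[OF p] by simp
    define l where "l = (e \<bullet> f) / (cmod e)\<^sup>2"
    have ne: "(Re e)\<^sup>2 + (Im e)\<^sup>2 \<noteq> 0" using False cmod_power2[of e] by auto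
    have "f = l *\<^sub>R e"
      unfolding complex_eq_iff l_def inner_complex_def cmod_power2 using ne cr
      by (simp add: field_simps power2_eq_square)
    moreover from this have "gform p e f = l * gform p e e" by (simp add: gform_def algebra_simps)
    ultimately have l: "f = l *\<^sub>R e" "l \<le> 0"
      using R gform_pos[OF p False] by (auto simp: e_def[symmetric] f_def[symmetric] mult_le_0_iff)
    have "y = p + l *\<^sub>R (x - p)" using l(1) by (simp add: e_def f_def algebra_simps)
    \<comment> \<open>The weight comes from solving y - p = l (x - p) for p; as l is nonpositive it
      is at most 1.\<close>
    then have "p = (1 - 1 / (1 - l)) *\<^sub>R x + (1 / (1 - l)) *\<^sub>R y"
      using l(2) by (simp add: complex_eq_iff divide_simps) (simp add: algebra_simps)
    then show ?thesis unfolding in_segment using l(2)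
      by (intro exI[of _ "1 / (1 - l)"]) (auto simp: field_simps)
  qed
qed

lemma hsegment_iff_klein:
  assumes z: "cmod z < 1" and w: "cmod w < 1" and u: "cmod u < 1"
  shows "u \<in> hsegment z w \<longleftrightarrow> klein u \<in> closed_segment (klein z) (klein w)"
proof -
  define x y p where "x = klein z" and "y = klein w" and "p = klein u"
  define sx sy sp where "sx = sqrt (1 - (cmod x)\<^sup>2)" and "sy = sqrt (1 - (cmod y)\<^sup>2)"
    and "sp = sqrt (1 - (cmod p)\<^sup>2)"
  have lt: "cmod x < 1" "cmod y < 1" "cmod p < 1" by (simp_all add: x_def y_def p_def cmod_klein_less z w u)
  have s: "0 < sx" "0 < sy" "0 < sp" "sx\<^sup>2 = 1 - (cmod x)\<^sup>2" "sy\<^sup>2 = 1 - (cmod y)\<^sup>2" "sp\<^sup>2 = 1 - (cmod p)\<^sup>2"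
    using lt[THEN one_minus_cmod_sq_pos] by (simp_all add: sx_def sy_def sp_def)
  define a b d where "a = hdist z u" and "b = hdist u w" and "d = hdist z w"
  have nn: "0 \<le> a" "0 \<le> b" "0 \<le> d" using hdist_nonneg z w u by (auto simp: a_def b_def d_def)
  have A: "cosh a * (sx * sp) = 1 - x \<bullet> p" and B: "cosh b * (sp * sy) = 1 - p \<bullet> y"
    and D: "cosh d * (sx * sy) = 1 - x \<bullet> y"
    unfolding a_def b_def d_def sx_def sy_def sp_def x_def y_def p_def
    using cosh_hdist_klein z w u by blast+
  define M where "M = sx * sy * sp\<^sup>2"
  have M: "0 < M" using s(1-3) by (simp add: M_def)
  define G where "G = sinh a * sinh b * M"
  have G: "0 \<le> G" using M nn by (simp add: G_def)
  let ?e = "x - p" and ?f = "y - p"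
  have ee: "(sinh a)\<^sup>2 * (sx\<^sup>2 * sp\<^sup>2) = gform p ?e ?e"
  proof -
    have "(sinh a)\<^sup>2 * (sx\<^sup>2 * sp\<^sup>2) = (cosh a * (sx * sp))\<^sup>2 - sx\<^sup>2 * sp\<^sup>2"
      unfolding sinh_square_eq by (simp add: algebra_simps power_mult_distrib)
    also have "\<dots> = gform p ?e ?e"
      unfolding A s(4,6) gform_def inner_complex_def cmod_power2 minus_complex.sel by algebra
    finally show ?thesis .
  qed
  have ff: "(sinh b)\<^sup>2 * (sy\<^sup>2 * sp\<^sup>2) = gform p ?f ?f"
  proof -
    have "(sinh b)\<^sup>2 * (sy\<^sup>2 * sp\<^sup>2) = (cosh b * (sp * sy))\<^sup>2 - sy\<^sup>2 * sp\<^sup>2"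
      unfolding sinh_square_eq by (simp add: algebra_simps power_mult_distrib)
    also have "\<dots> = gform p ?f ?f"
      unfolding B s(5,6) gform_def inner_complex_def cmod_power2 minus_complex.sel by algebra
    finally show ?thesis .
  qed
  have ef: "(cosh a * cosh b - cosh d) * M = gform p ?e ?f"
  proof -
    have "(cosh a * cosh b - cosh d) * M
        = (cosh a * (sx * sp)) * (cosh b * (sp * sy)) - (cosh d * (sx * sy)) * sp\<^sup>2"
      unfolding M_def by algebra
    also have "\<dots> = gform p ?e ?f"
      unfolding A B D s(6) gform_def inner_complex_def cmod_power2 minus_complex.sel by algebra
    finally show ?thesis .
  qed
  have G2: "G\<^sup>2 = gform p ?e ?e * gform p ?f ?f"
    unfolding ee[symmetric] ff[symmetric] G_def M_def by algebra
  have "u \<in> hsegment z w \<longleftrightarrow> a + b = d"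
    using u by (simp add: hsegment_def a_def b_def d_def)
  also have "\<dots> \<longleftrightarrow> cosh (a + b) = cosh d" using nn by simp
  also have "\<dots> \<longleftrightarrow> (cosh a * cosh b + sinh a * sinh b) * M = cosh d * M"
    using M by (simp add: cosh_add)
  also have "\<dots> \<longleftrightarrow> G = - gform p ?e ?f"
    unfolding ef[symmetric] G_def by (auto simp: algebra_simps)
  \<comment> \<open>\<open>G\<close> is nonnegative, so squaring loses only the sign of
    \<open>gform\<close>, kept as a separate conjunct.\<close>
  also have "\<dots> \<longleftrightarrow> gform p ?e ?f \<le> 0 \<and> G\<^sup>2 = (gform p ?e ?f)\<^sup>2"
    using G by (auto simp: power2_eq_iff)
  also have "\<dots> \<longleftrightarrow> p \<in> closed_segment x y"
    unfolding gform_closed_segment[OF lt(3)] G2 ..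
  finally show ?thesis unfolding x_def y_def p_def .
qed

text \<open>The three ranges of s match the three alternatives in \<open>hline\<close>. This
  produces the forbidden points: a second intersection with the incircle, and a third vertex on the
  geodesic of a side.\<close>

lemma hlineI:
  assumes z: "cmod z < 1" and w: "cmod w < 1" and u: "cmod u < 1"
    and eq: "klein u = klein z + s *\<^sub>R (klein w - klein z)"
  shows "u \<in> hline z w"
proof -
  consider "s < 0" | "0 \<le> s" "s \<le> 1" | "1 < s" by linarith
  then have "klein z \<in> closed_segment (klein u) (klein w) \<or> klein u \<in> closed_segment (klein z) (klein w)
      \<or> klein w \<in> closed_segment (klein z) (klein u)"
  proof cases
    case 1
    have "klein z = (1 - (- s) / (1 - s)) *\<^sub>R klein u + ((- s) / (1 - s)) *\<^sub>R klein w"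
      unfolding eq using 1 by (simp add: complex_eq_iff divide_simps) (simp add: algebra_simps)
    then show ?thesis unfolding in_segment using 1
      by (intro disjI1 exI[of _ "(- s) / (1 - s)"]) (auto simp: field_simps)
  next
    case 2
    then show ?thesis unfolding in_segment eq
      by (intro disjI2 disjI1 exI[of _ s]) (auto simp: algebra_simps)
  next
    case 3
    have "klein w = (1 - 1 / s) *\<^sub>R klein z + (1 / s) *\<^sub>R klein u"
      unfolding eq using 3 by (simp add: complex_eq_iff field_simps)
    then show ?thesis unfolding in_segment using 3
      by (intro disjI2 exI[of _ "1 / s"]) (auto simp: field_simps)
  qed
  then show ?thesis using hsegment_iff_klein z w u by (auto simp: hline_def)
qed

lemma tanh_hdist_zero: "cmod u < 1 \<Longrightarrow> tanh (hdist 0 u) = cmod (klein u)"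
proof -
  assume u: "cmod u < 1"
  have "tanh (hdist 0 u) = tanh (artanh (cmod u) + artanh (cmod u))" by (simp add: hdist_def to_origin_def)
  also have "\<dots> = 2 * cmod u / (1 + (cmod u)\<^sup>2)"
    using u by (subst tanh_add) (auto simp: tanh_artanh_real power2_eq_square)
  also have "\<dots> = cmod (klein u)"
    by (simp add: cmod_klein)
  finally show ?thesis .
qed

lemma hcircle_zero_iff: "cmod u < 1 \<Longrightarrow> u \<in> hcircle 0 r \<longleftrightarrow> cmod (klein u) = tanh r"
  by (auto simp: hcircle_def tanh_hdist_zero[symmetric])

text \<open>The right triangle with legs r and d and angle arctan |\<tau>| at the centre satisfies
  tanh d = sinh r * |\<tau>|. At the origin the Klein model shows true angles.\<close>

lemma hdist_tangent:
  assumes "cmod t < 1" "cmod v < 1" and y: "cmod (klein t) = tanh r" and r: "0 < r"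
    and v: "klein v = klein t * (1 + \<i> * of_real \<tau>)"
  shows "sinh r * \<bar>\<tau>\<bar> < 1" and "hdist t v = artanh (sinh r * \<bar>\<tau>\<bar>)"
proof -
  define R where "R = tanh r"
  define d where "d = hdist t v"
  have d: "0 \<le> d" using hdist_nonneg assms by (simp add: d_def)
  have 1: "klein t \<bullet> klein v = R\<^sup>2"
    unfolding v R_def y[symmetric] cmod_power2 inner_complex_def by (simp add: algebra_simps power2_eq_square)
  have "(cmod (1 + \<i> * of_real \<tau>))\<^sup>2 = 1 + \<tau>\<^sup>2" by (simp add: cmod_power2)
  then have 2: "(cmod (klein v))\<^sup>2 = R\<^sup>2 * (1 + \<tau>\<^sup>2)" by (simp add: v norm_mult power_mult_distrib y R_def)
  have R: "0 < 1 - R\<^sup>2" "0 < 1 - R\<^sup>2 * (1 + \<tau>\<^sup>2)"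
    using one_minus_cmod_sq_pos[OF cmod_klein_less] assms 2 R_def by metis+
  have "(cosh d * (sqrt (1 - R\<^sup>2) * sqrt (1 - R\<^sup>2 * (1 + \<tau>\<^sup>2))))\<^sup>2 = (1 - R\<^sup>2)\<^sup>2"
    using cosh_hdist_klein[of t v] assms 1 2 by (simp add: d_def R_def)
  then have "(cosh d)\<^sup>2 * ((1 - R\<^sup>2) * (1 - R\<^sup>2 * (1 + \<tau>\<^sup>2))) = (1 - R\<^sup>2) * (1 - R\<^sup>2)"
    using R by (simp add: power_mult_distrib) (simp add: power2_eq_square)
  then have 3: "(cosh d)\<^sup>2 * (1 - R\<^sup>2 * (1 + \<tau>\<^sup>2)) = 1 - R\<^sup>2"
    using R by simp
  have s: "(cosh r)\<^sup>2 * R\<^sup>2 = (sinh r)\<^sup>2" by (simp add: R_def tanh_def power_divide)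
  have "(cosh r)\<^sup>2 * ((cosh d)\<^sup>2 * (1 - R\<^sup>2 * (1 + \<tau>\<^sup>2))) = (cosh r)\<^sup>2 * (1 - R\<^sup>2)" using 3 by simp
  then have "(cosh d)\<^sup>2 * ((cosh r)\<^sup>2 - (sinh r)\<^sup>2 * (1 + \<tau>\<^sup>2)) = (cosh r)\<^sup>2 - (sinh r)\<^sup>2"
    unfolding s[symmetric] by algebra
  then have 4: "(cosh d)\<^sup>2 * (1 - (sinh r)\<^sup>2 * \<tau>\<^sup>2) = 1"
    unfolding cosh_square_eq[of r] by (simp add: algebra_simps)
  have "(tanh d)\<^sup>2 = (sinh r * \<bar>\<tau>\<bar>)\<^sup>2"
  proof -
    have "(sinh d)\<^sup>2 = (cosh d)\<^sup>2 * ((sinh r)\<^sup>2 * \<tau>\<^sup>2)"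
      using 4 unfolding sinh_square_eq by (simp add: algebra_simps)
    then show ?thesis by (simp add: tanh_def power_divide power_mult_distrib)
  qed
  then have "tanh d = sinh r * \<bar>\<tau>\<bar>" using d r by (simp add: power2_eq_iff_nonneg)
  then show "sinh r * \<bar>\<tau>\<bar> < 1" "hdist t v = artanh (sinh r * \<bar>\<tau>\<bar>)"
    using tanh_real_lt_1[of d] artanh_tanh_real[of d] by (auto simp: d_def)
qed

section \<open>Contact points of a tangential polygon\<close>

text \<open>
  The centre of the incircle is moved to the origin, where Euclidean circles, radii and right angles
  in the Klein model are hyperbolic ones. Indices are not reduced modulo \<open>n\<close>.
\<close>

locale tangential_polygon =
  fixes n :: nat and v :: "nat \<Rightarrow> complex" and r :: real
  assumes n: "n \<ge> 3" and r: "0 < r"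
    and periodic: "v (j + n) = v j"
    and in_disc: "cmod (v j) < 1"
    and distinct: "\<lbrakk>i < n; j < n; v i = v j\<rbrakk> \<Longrightarrow> i = j"
    and not_collinear: "v (Suc (Suc j)) \<notin> hline (v j) (v (Suc j))"
    and tangent: "\<exists>t\<in>hsegment (v j) (v (Suc j)). hline (v j) (v (Suc j)) \<inter> hcircle 0 r = {t}"
    and simple: "\<lbrakk>i < n; j < n; i \<noteq> j\<rbrakk> \<Longrightarrow>
      hsegment (v i) (v (Suc i)) \<inter> hsegment (v j) (v (Suc j)) \<subseteq> {v i, v (Suc i)} \<inter> {v j, v (Suc j)}"
begin

lemma v_mod: "v (j mod n) = v j"
proof -
  have "v (j + k * n) = v j" for j k
  proof (induction k)
    case (Suc k)
    have "v (j + Suc k * n) = v ((j + k * n) + n)" by (simp add: add.commute add.left_commute)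
    then show ?case using Suc periodic by simp
  qed simp
  from this[of "j mod n" "j div n"] show ?thesis by simp
qed

lemma v_Suc_mod: "v (Suc (j mod n)) = v (Suc j)"
  by (metis v_mod mod_Suc_eq)

lemma v_eq_iff: "v i = v j \<longleftrightarrow> i mod n = j mod n"
  using distinct[of "i mod n" "j mod n"] v_mod n by (metis mod_less_divisor not_numeral_le_zero gr0I)

lemma v_Suc_neq: "v (Suc j) \<noteq> v j"
proof
  assume "v (Suc j) = v j"
  then have "Suc j mod n = j mod n" by (simp add: v_eq_iff)
  then show False using n by (auto simp: mod_Suc split: if_splits)
qed

text \<open>Perpendicularity to the radius makes the ends y plus imaginary multiples of y. That the
  contact point lies on the side itself gives \<open>0 \<le> \<tau> * \<sigma>\<close>; the common
  sign tells in which sense the side runs around the centre.\<close>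

lemma side_coordinates:
  "\<exists>y \<tau> \<sigma>. cmod y = tanh r \<and> klein (v j) = y * (1 - \<i> * of_real \<tau>) \<and>
     klein (v (Suc j)) = y * (1 + \<i> * of_real \<sigma>) \<and> 0 \<le> \<tau> * \<sigma> \<and>
     sinh r * \<bar>\<tau>\<bar> < 1 \<and> sinh r * \<bar>\<sigma>\<bar> < 1 \<and>
     hdist (v j) (v (Suc j)) = artanh (sinh r * \<bar>\<tau>\<bar>) + artanh (sinh r * \<bar>\<sigma>\<bar>)"
proof -
  obtain t where t: "t \<in> hsegment (v j) (v (Suc j))" "hline (v j) (v (Suc j)) \<inter> hcircle 0 r = {t}"
    using tangent by blast
  then have t1: "cmod t < 1" by (simp add: hsegment_def)
  define y where "y = klein t"
  define d where "d = klein (v (Suc j)) - klein (v j)"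
  have d: "d \<noteq> 0"
    using v_Suc_neq[of j] klein_inj[OF in_disc in_disc, of "Suc j" j] by (auto simp: d_def)
  have yr: "cmod y = tanh r" using t(2) hcircle_zero_iff[OF t1] by (auto simp: y_def)
  have y0: "y \<noteq> 0" using yr r by auto
  obtain s where s: "0 \<le> s" "s \<le> 1" "y = klein (v j) + s *\<^sub>R d"
    using t(1) hsegment_iff_klein[OF in_disc in_disc t1]
    by (auto simp: in_segment y_def d_def algebra_simps)
  \<comment> \<open>otherwise the chord meets the circle in a second point, which also lies in the disc\<close>
  have perp: "y \<bullet> d = 0"
  proof (rule ccontr)
    assume ne: "y \<bullet> d \<noteq> 0"
    \<comment> \<open>The nonzero root of |y + q d| = |y|.\<close>
    define q where "q = - 2 * (y \<bullet> d) / (d \<bullet> d)"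
    define p where "p = y + q *\<^sub>R d"
    have "p \<bullet> p = y \<bullet> y + q * (2 * (y \<bullet> d) + q * (d \<bullet> d))"
      by (simp add: p_def algebra_simps inner_commute)
    also have "2 * (y \<bullet> d) + q * (d \<bullet> d) = 0" using d by (simp add: q_def)
    finally have "cmod p = cmod y" by (simp add: norm_eq_sqrt_inner)
    then have p: "cmod p = tanh r" by (simp add: yr)
    then have p1: "cmod p < 1" by (simp add: tanh_real_lt_1)
    have "klein (klein_inv p) = klein (v j) + (s + q) *\<^sub>R (klein (v (Suc j)) - klein (v j))"
      unfolding klein_klein_inv(2)[OF p1] d_def[symmetric] by (simp add: p_def s(3) algebra_simps)
    then have "klein_inv p \<in> hline (v j) (v (Suc j))"
      by (rule hlineI[OF in_disc in_disc klein_klein_inv(1)[OF p1]])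
    moreover have "klein_inv p \<in> hcircle 0 r"
      using hcircle_zero_iff[OF klein_klein_inv(1)[OF p1]] klein_klein_inv(2)[OF p1] p by simp
    ultimately have "klein_inv p = t" using t(2) by blast
    then have "p = y" using klein_klein_inv(2)[OF p1] by (simp add: y_def)
    then show False using ne d by (simp add: p_def q_def)
  qed
  define l where "l = Im (d / y)"
  have "Re (d / y) = 0" using perp by (simp add: Re_divide inner_complex_def algebra_simps)
  then have "d / y = \<i> * of_real l" by (simp add: complex_eq_iff l_def)
  then have dl: "d = y * (\<i> * of_real l)" using y0 by (simp add: field_simps)
  define \<tau> \<sigma> where "\<tau> = s * l" and "\<sigma> = (1 - s) * l"
  have 1: "klein (v j) = y * (1 - \<i> * of_real \<tau>)"
  proof -
    have "klein (v j) = y - of_real s * d" by (simp add: s(3) scaleR_conv_of_real)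
    then show ?thesis unfolding dl \<tau>_def by (simp add: algebra_simps)
  qed
  have 2: "klein (v (Suc j)) = y * (1 + \<i> * of_real \<sigma>)"
  proof -
    have "klein (v (Suc j)) = klein (v j) + d" by (simp add: d_def)
    then show ?thesis unfolding 1 unfolding dl \<tau>_def \<sigma>_def by (simp add: algebra_simps)
  qed
  have "\<tau> * \<sigma> = s * (1 - s) * l\<^sup>2" by (simp add: \<tau>_def \<sigma>_def power2_eq_square)
  then have 3: "0 \<le> \<tau> * \<sigma>" using s by simp
  have T: "sinh r * \<bar>\<tau>\<bar> < 1" "hdist t (v j) = artanh (sinh r * \<bar>\<tau>\<bar>)"
    using hdist_tangent[OF t1 in_disc[of j], of r "- \<tau>"] yr r 1 by (simp_all add: y_def)
  have S: "sinh r * \<bar>\<sigma>\<bar> < 1" "hdist t (v (Suc j)) = artanh (sinh r * \<bar>\<sigma>\<bar>)"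
    using hdist_tangent[OF t1 in_disc[of "Suc j"], of r "\<sigma>"] yr r 2 by (simp_all add: y_def)
  have "hdist (v j) t = hdist t (v j)"
    by (rule hdist_commute[OF in_disc t1])
  then have "hdist (v j) (v (Suc j)) = artanh (sinh r * \<bar>\<tau>\<bar>) + artanh (sinh r * \<bar>\<sigma>\<bar>)"
    using t(1) T(2) S(2) by (simp add: hsegment_def)
  then show ?thesis using yr 1 2 3 T(1) S(1) by blast
qed

text \<open>Both sides at a vertex determine its distance from the centre, so their tangent
  parameters agree up to sign. Opposite signs would put the two sides on one geodesic. Hence one
  parameter per vertex remains, and it is nonzero because 0 is its own opposite.\<close>

lemma tangent_coordinates:
  "\<exists>y \<tau>. (\<forall>j. \<tau> (j + n) = \<tau> j \<and> y (j + n) = y j \<and> cmod (y j) = tanh r \<and> klein (v j) = y j * (1 - \<i> * of_real (\<tau> j)) \<and>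
     klein (v (Suc j)) = y j * (1 + \<i> * of_real (\<tau> (Suc j))) \<and> 0 < \<tau> j * \<tau> (Suc j) \<and>
     sinh r * \<bar>\<tau> j\<bar> < 1 \<and>
     hdist (v j) (v (Suc j)) = artanh (sinh r * \<bar>\<tau> j\<bar>) + artanh (sinh r * \<bar>\<tau> (Suc j)\<bar>))"
proof -
  obtain y' \<tau>' \<sigma>' where c': "\<And>j. cmod (y' j) = tanh r \<and> klein (v j) = y' j * (1 - \<i> * of_real (\<tau>' j)) \<and>
     klein (v (Suc j)) = y' j * (1 + \<i> * of_real (\<sigma>' j)) \<and> 0 \<le> \<tau>' j * \<sigma>' j \<and>
     sinh r * \<bar>\<tau>' j\<bar> < 1 \<and> sinh r * \<bar>\<sigma>' j\<bar> < 1 \<and>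
     hdist (v j) (v (Suc j)) = artanh (sinh r * \<bar>\<tau>' j\<bar>) + artanh (sinh r * \<bar>\<sigma>' j\<bar>)"
    using side_coordinates by metis
  \<comment> \<open>The chosen coordinates need not be periodic; reading them at
    \<open>j mod n\<close> makes them so.\<close>
  define y \<tau> \<sigma> where "y j = y' (j mod n)" and "\<tau> j = \<tau>' (j mod n)" and "\<sigma> j = \<sigma>' (j mod n)" for j
  have c: "cmod (y j) = tanh r" "klein (v j) = y j * (1 - \<i> * of_real (\<tau> j))"
     "klein (v (Suc j)) = y j * (1 + \<i> * of_real (\<sigma> j))" "0 \<le> \<tau> j * \<sigma> j"
     "sinh r * \<bar>\<tau> j\<bar> < 1" "sinh r * \<bar>\<sigma> j\<bar> < 1"
     "hdist (v j) (v (Suc j)) = artanh (sinh r * \<bar>\<tau> j\<bar>) + artanh (sinh r * \<bar>\<sigma> j\<bar>)" for j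
    using c'[of "j mod n"] by (simp_all add: v_mod v_Suc_mod y_def \<tau>_def \<sigma>_def)
  have y0: "y j \<noteq> 0" for j using c(1)[of j] r by auto
  \<comment> \<open>otherwise consecutive sides touch the circle in the same point and lie on one geodesic\<close>
  have ne: "\<sigma> j \<noteq> - \<tau> (Suc j)" for j
  proof
    assume e: "\<sigma> j = - \<tau> (Suc j)"
    have n0: "1 + \<i> * of_real (\<sigma> j) \<noteq> 0" by (simp add: complex_eq_iff)
    have "y j * (1 + \<i> * of_real (\<sigma> j)) = y (Suc j) * (1 + \<i> * of_real (\<sigma> j))"
      using c(3)[of j] c(2)[of "Suc j"] e by simp
    then have yy: "y (Suc j) = y j" using n0 by simp
    have st: "\<sigma> j + \<tau> j \<noteq> 0"
    proof
      assume "\<sigma> j + \<tau> j = 0"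
      then have "\<sigma> j = - \<tau> j" by simp
      then have "klein (v (Suc j)) = klein (v j)" unfolding c(2)[of j] c(3)[of j] by simp
      then show False using klein_inj[OF in_disc in_disc] v_Suc_neq by blast
    qed
    \<comment> \<open>The position of the third vertex on the common tangent line, in units of the
      first side.\<close>
    define q where "q = (\<sigma> (Suc j) + \<tau> j) / (\<sigma> j + \<tau> j)"
    have q: "\<sigma> (Suc j) = q * (\<sigma> j + \<tau> j) - \<tau> j" using st by (simp add: q_def)
    have "klein (v (Suc (Suc j))) = klein (v j) + q *\<^sub>R (klein (v (Suc j)) - klein (v j))"
      unfolding c(2)[of j] c(3)[of j] c(3)[of "Suc j"] yy q
      by (simp add: scaleR_conv_of_real algebra_simps)
    then have "v (Suc (Suc j)) \<in> hline (v j) (v (Suc j))"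
      by (rule hlineI[OF in_disc in_disc in_disc])
    then show False using not_collinear by blast
  qed
  have st: "\<sigma> j = \<tau> (Suc j)" for j
  proof -
    have "cmod (1 + \<i> * of_real (\<sigma> j)) = cmod (1 - \<i> * of_real (\<tau> (Suc j)))"
      using arg_cong[OF c(3)[of j, unfolded c(2)[of "Suc j"]], of cmod] r
      by (simp add: norm_mult c(1))
    then have "(\<sigma> j)\<^sup>2 = (\<tau> (Suc j))\<^sup>2" by (simp add: cmod_def)
    then show ?thesis using ne by (auto simp: power2_eq_iff)
  qed
  have nz: "\<tau> (Suc j) \<noteq> 0" for j using ne[of j] st[of j] by auto
  have "\<tau> j \<noteq> 0" for j
  proof -
    \<comment> \<open>j + n - 1 acts as the predecessor of j, also for j = 0.\<close>
    have "\<tau> j = \<tau> (Suc (j + n - 1))" using n by (simp add: \<tau>_def)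
    then show ?thesis using nz by metis
  qed
  then have "0 < \<tau> j * \<tau> (Suc j)" for j
    using c(4)[of j] st[of j] by (metis less_eq_real_def mult_eq_0_iff)
  then show ?thesis
    using c st by (intro exI[of _ y] exI[of _ \<tau>]) (auto simp: y_def \<tau>_def)
qed

end

lemma one_plus_i_tan: "cos a \<noteq> 0 \<Longrightarrow> 1 + \<i> * of_real (tan a) = cis a / of_real (cos a)"
  by (simp add: complex_eq_iff tan_def)

text \<open>
  \<open>y j\<close> is the contact point of side \<open>j\<close> (in the Klein model), \<open>2 * \<alpha> j\<close> is the angle
  between consecutive contact points, \<open>\<epsilon>\<close> is the orientation and \<open>m\<close> the winding number
  of the boundary. The tangent length is \<open>artanh (sinh r * tan \<alpha>)\<close> by hyperbolic trigonometry.
\<close>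

locale tangential_polygon_coords = tangential_polygon +
  fixes y :: "nat \<Rightarrow> complex" and \<alpha> :: "nat \<Rightarrow> real" and \<epsilon> :: real and m :: nat
  assumes eps: "\<epsilon> = 1 \<or> \<epsilon> = - 1" and m: "1 \<le> m"
    and alpha_periodic: "\<alpha> (j + n) = \<alpha> j"
    and alpha: "0 < \<alpha> j" "\<alpha> j < pi / 2" "sinh r * tan (\<alpha> j) < 1"
    and alpha_sum: "(\<Sum>j<n. \<alpha> j) = real m * pi"
    and cmod_y: "cmod (y j) = tanh r"
    and y_Suc: "y (Suc j) = y j * cis (2 * \<epsilon> * \<alpha> (Suc j))"
    and klein_v: "klein (v j) = y j * (1 - \<i> * of_real (\<epsilon> * tan (\<alpha> j)))"
    and klein_v_Suc: "klein (v (Suc j)) = y j * (1 + \<i> * of_real (\<epsilon> * tan (\<alpha> (Suc j))))"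
    and hdist_v: "hdist (v j) (v (Suc j))
      = artanh (sinh r * tan (\<alpha> j)) + artanh (sinh r * tan (\<alpha> (Suc j)))"

context tangential_polygon
begin

text \<open>Consecutive \<tau> have equal signs, so one \<epsilon> serves for all. Equating the two
  expressions for a vertex through \<open>one_plus_i_tan\<close> shows that the contact points
  advance by the angle 2 \<epsilon> \<alpha>; after n steps they return, so the positive sum of the
  \<alpha> is an integral multiple of pi.\<close>

lemma coords_exist: "\<exists>y \<alpha> \<epsilon> m. tangential_polygon_coords n v r y \<alpha> \<epsilon> m"
proof -
  obtain y \<tau> where c: "\<And>j. \<tau> (j + n) = \<tau> j" "\<And>j. y (j + n) = y j" "\<And>j. cmod (y j) = tanh r"
     "\<And>j. klein (v j) = y j * (1 - \<i> * of_real (\<tau> j))"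
     "\<And>j. klein (v (Suc j)) = y j * (1 + \<i> * of_real (\<tau> (Suc j)))" "\<And>j. 0 < \<tau> j * \<tau> (Suc j)"
     "\<And>j. sinh r * \<bar>\<tau> j\<bar> < 1"
     "\<And>j. hdist (v j) (v (Suc j)) = artanh (sinh r * \<bar>\<tau> j\<bar>) + artanh (sinh r * \<bar>\<tau> (Suc j)\<bar>)"
    using tangent_coordinates by metis
  define \<epsilon> where "\<epsilon> = sgn (\<tau> 0)"
  have "sgn (\<tau> j) = \<epsilon>" for j
  proof (induction j)
    case (Suc j)
    then show ?case using c(6)[of j] by (auto simp: zero_less_mult_iff sgn_if split: if_splits)
  qed (simp add: \<epsilon>_def)
  then have \<tau>: "\<tau> j = \<epsilon> * \<bar>\<tau> j\<bar>" for j by (metis mult_sgn_abs)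
  have \<tau>0: "\<tau> j \<noteq> 0" for j using c(6)[of j] by auto
  have eps: "\<epsilon> = 1 \<or> \<epsilon> = - 1" using \<tau>0[of 0] by (auto simp: \<epsilon>_def sgn_if)
  define \<alpha> where "\<alpha> j = arctan \<bar>\<tau> j\<bar>" for j
  have \<alpha>: "0 < \<alpha> j" "\<alpha> j < pi / 2" "tan (\<alpha> j) = \<bar>\<tau> j\<bar>" for j
    using \<tau>0[of j] arctan_ubound[of "\<bar>\<tau> j\<bar>"] by (auto simp: \<alpha>_def tan_arctan)
  have t: "\<tau> j = \<epsilon> * tan (\<alpha> j)" for j using \<tau>[of j] \<alpha>(3)[of j] by simp
  have t': "\<tau> j = tan (\<epsilon> * \<alpha> j)" for j using t[of j] eps by auto
  have cos: "cos (\<epsilon> * \<alpha> j) \<noteq> 0" for j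
    using eps \<alpha>[of j] cos_gt_zero[of "\<alpha> j"] by auto
  have y0: "y j \<noteq> 0" for j using c(3)[of j] r by auto
  have y_Suc: "y (Suc j) = y j * cis (2 * \<epsilon> * \<alpha> (Suc j))" for j
  proof -
    let ?a = "\<epsilon> * \<alpha> (Suc j)"
    have "y (Suc j) * (1 + \<i> * of_real (tan (- ?a))) = y j * (1 + \<i> * of_real (tan ?a))"
      using c(4)[of "Suc j"] c(5)[of j] t'[of "Suc j"] by simp
    then have "y (Suc j) * cis (- ?a) = y j * cis ?a"
      using cos[of "Suc j"] one_plus_i_tan[of ?a] one_plus_i_tan[of "- ?a"] by simp
    then have "y (Suc j) * (cis (- ?a) * cis ?a) = y j * (cis ?a * cis ?a)"
      by (simp only: mult.assoc[symmetric])
    then show ?thesis unfolding cis_mult by (simp add: algebra_simps)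
  qed
  have y_sum: "y j = y 0 * cis (2 * \<epsilon> * (\<Sum>i<j. \<alpha> (Suc i)))" for j
    by (induction j) (simp_all add: y_Suc mult.assoc cis_mult algebra_simps)
  have alp: "\<alpha> (j + n) = \<alpha> j" for j by (simp add: \<alpha>_def c(1))
  have shift: "(\<Sum>i<n. \<alpha> (Suc i)) = (\<Sum>i<n. \<alpha> i)"
    using sum.lessThan_Suc_shift[of \<alpha> n] alp[of 0] by simp
  define S where "S = (\<Sum>i<n. \<alpha> i)"
  have S: "0 < S" unfolding S_def using \<alpha> n by (intro sum_pos) (auto simp: lessThan_empty_iff)
  have "cis (2 * \<epsilon> * S) = 1" using y_sum[of n] c(2)[of 0] y0[of 0] shift by (simp add: S_def)
  then have "cos (2 * S) = 1" using eps by (auto simp: complex_eq_iff)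
  then obtain k :: int where k: "2 * S = of_int k * 2 * pi" by (auto simp: cos_one_2pi_int)
  then have "0 < of_int k * pi" using S by simp
  then have "0 < k" by (simp add: zero_less_mult_iff)
  then have "S = real (nat k) * pi" "1 \<le> nat k" using k by auto
  then have "tangential_polygon_coords n v r y \<alpha> \<epsilon> (nat k)"
    using eps alp \<alpha> c(3-8) y_Suc t S_def by unfold_locales (simp_all)
  then show ?thesis by blast
qed

end

section \<open>Perimeter and regularity\<close>

lemma cmod_klein_inv: "cmod (klein_inv x) = cmod x / \<bar>1 + sqrt (1 - (cmod x)\<^sup>2)\<bar>"
  unfolding klein_inv_def norm_mult norm_of_real by simp

lemma closed_segment_tangent:
  assumes "\<bar>t\<bar> \<le> \<bar>T\<bar>" "T \<noteq> 0"
  shows "y * (1 + \<i> * of_real t) \<in> closed_segment (y * (1 - \<i> * of_real T)) (y * (1 + \<i> * of_real T))"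
proof -
  define s where "s = (t + T) / (2 * T)"
  have t: "t = 2 * s * T - T" using assms by (simp add: s_def field_simps)
  have "0 \<le> s" "s \<le> 1"
    using assms by (auto simp: s_def divide_simps split: if_splits)
  moreover have "y * (1 + \<i> * of_real t)
      = (1 - s) *\<^sub>R (y * (1 - \<i> * of_real T)) + s *\<^sub>R (y * (1 + \<i> * of_real T))"
    unfolding t by (simp add: scaleR_conv_of_real algebra_simps)
  ultimately show ?thesis unfolding in_segment by blast
qed

text \<open>The Euclidean distance from 0 to the vertices of a regular n-gon of inradius r centred
  there: the contact point tanh r, continued along the tangent, gives the vertex in the Klein model.
  Depending on n and r only, it yields one normal form for all polygons in the equality
  case.\<close>

definition regular_vertex_norm :: "nat \<Rightarrow> real \<Rightarrow> real" where
  "regular_vertex_norm n r = cmod (klein_inv (of_real (tanh r) * (1 + \<i> * of_real (tan (pi / real n)))))"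

context tangential_polygon_coords
begin

lemma sinh_r_pos: "0 < sinh r" using r by simp

lemma y_neq_zero: "y j \<noteq> 0" using cmod_y[of j] r by auto

lemma v_neq_zero: "v j \<noteq> 0"
proof
  assume "v j = 0"
  then have "y j * (1 - \<i> * of_real (\<epsilon> * tan (\<alpha> j))) = 0" using klein_v[of j] by (simp add: klein_def)
  moreover have "1 - \<i> * of_real (\<epsilon> * tan (\<alpha> j)) \<noteq> 0" by (simp add: complex_eq_iff)
  ultimately show False using y_neq_zero[of j] by simp
qed

lemma perimeter_eq: "(\<Sum>j<n. hdist (v j) (v (Suc j))) = 2 * (\<Sum>j<n. artanh (sinh r * tan (\<alpha> j)))"
proof -
  let ?f = "\<lambda>j. artanh (sinh r * tan (\<alpha> j))"
  have "(\<Sum>j<n. ?f (Suc j)) = (\<Sum>j<n. ?f j)"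
    using sum.lessThan_Suc_shift[of ?f n] alpha_periodic[of 0] by simp
  then show ?thesis by (simp add: hdist_v sum.distrib)
qed

lemma alpha_total: "pi \<le> (\<Sum>j<n. \<alpha> j)"
  using m by (simp add: alpha_sum)

lemma inradius_bound: "tan (pi / real n) * sinh r < 1"
  using sum_artanh_tan(1)[of "sinh r" "{..<n}" n \<alpha>] sinh_r_pos n alpha alpha_total
  by (simp add: mult.commute)

lemma perimeter_ge:
  "2 * real n * artanh (tan (pi / real n) * sinh r) \<le> (\<Sum>j<n. hdist (v j) (v (Suc j)))"
  using sum_artanh_tan(2)[of "sinh r" "{..<n}" n \<alpha>] sinh_r_pos n alpha alpha_total
  by (simp add: perimeter_eq mult.commute)

lemma perimeter_equality:
  assumes "(\<Sum>j<n. hdist (v j) (v (Suc j))) = 2 * real n * artanh (tan (pi / real n) * sinh r)"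
  shows "\<alpha> j = pi / real n"
proof -
  have "\<alpha> (j mod n) = pi / real n"
    using sum_artanh_tan(3)[of "sinh r" "{..<n}" n \<alpha> "j mod n"] sinh_r_pos n alpha alpha_total assms
    by (simp add: perimeter_eq mult.commute)
  moreover have "\<alpha> (i + k * n) = \<alpha> i" for i k
  proof (induction k)
    case (Suc k)
    have "\<alpha> (i + Suc k * n) = \<alpha> ((i + k * n) + n)" by (simp add: add.commute add.left_commute)
    then show ?case using Suc alpha_periodic by simp
  qed simp
  from this[of "j mod n" "j div n"] have "\<alpha> (j mod n) = \<alpha> j" by simp
  ultimately show ?thesis by simp
qed

lemma v_rotation:
  assumes "klein (v j) = klein (v i) * cis \<phi>"
  shows "v j = v i * cis \<phi>"
proof (rule klein_inj)
  show "klein (v j) = klein (v i * cis \<phi>)"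
    using klein_rotation[of "cis \<phi>" "v i"] assms by (simp add: mult.commute)
qed (simp_all add: in_disc norm_mult)

lemma y_constant_angle: "(\<And>j. \<alpha> j = a) \<Longrightarrow> y j = y 0 * cis (2 * \<epsilon> * real j * a)"
  by (induction j) (simp_all add: y_Suc mult.assoc cis_mult algebra_simps)

lemma v_constant_angle:
  assumes a: "\<And>j. \<alpha> j = a"
  shows "v j = v 0 * cis (2 * \<epsilon> * real j * a)"
  by (rule v_rotation) (simp add: klein_v a y_constant_angle[OF a, of j])

text \<open>
  If \<open>m \<ge> 2\<close>, the contact points are the vertices of a regular star polygon, and two of them that are
  neighbours on the circle belong to sides crossing at the angle \<open>pi / n < a\<close> from either.
\<close>

lemma winding_number_one:
  assumes a: "\<And>j. \<alpha> j = a"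
  shows "m = 1"
proof (rule ccontr)
  assume "m \<noteq> 1"
  then have m2: "m \<ge> 2" using m by simp
  have na: "real n * a = real m * pi" using alpha_sum a by simp
  then have a_eq: "a = real m * pi / real n" using n by (simp add: field_simps)
  have a01: "0 < a" "a < pi / 2" using alpha(1,2)[of 0] a by simp_all
  define \<delta> where "\<delta> = pi / real n"
  have "2 * pi \<le> real m * pi" using m2 by simp
  then have "2 * \<delta> \<le> a" using n unfolding a_eq \<delta>_def by (simp add: divide_simps)
  then have \<delta>: "0 < \<delta>" "\<delta> < a" using n a01 by (auto simp: \<delta>_def)
  have cis_eq: "cis (2 * \<epsilon> * real j * a) = cis (2 * \<epsilon> * real ((j * m) mod n) * \<delta>)" for j
  proof -
    have "real (j * m) = real ((j * m) div n) * real n + real ((j * m) mod n)"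
      by (metis div_mult_mod_eq of_nat_add of_nat_mult)
    then have "real j * a = real ((j * m) div n) * pi + real ((j * m) mod n) * \<delta>"
      using n unfolding a_eq \<delta>_def by (simp add: field_simps)
    moreover have "2 * \<epsilon> * real j * a = 2 * \<epsilon> * (real j * a)" by simp
    ultimately have "2 * \<epsilon> * real j * a
        = 2 * pi * (\<epsilon> * real ((j * m) div n)) + 2 * \<epsilon> * real ((j * m) mod n) * \<delta>"
      by (simp only: distrib_left) simp
    moreover have "\<epsilon> * real ((j * m) div n) \<in> \<int>" using eps by auto
    ultimately show ?thesis by (simp add: cis_mult[symmetric])
  qed
  \<comment> \<open>Equal residues would give equal vertices. So multiplication by m permutes the
    residues, and some side j touches the circle at angle 2 \<delta> from the contact point of side
    0.\<close>
  have "inj_on (\<lambda>j. (j * m) mod n) {..<n}"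
  proof (rule inj_onI)
    fix i j assume ij: "i \<in> {..<n}" "j \<in> {..<n}" "(i * m) mod n = (j * m) mod n"
    then have "v i = v j" using v_constant_angle[OF a, of i] v_constant_angle[OF a, of j] cis_eq by simp
    then show "i = j" using distinct ij by simp
  qed
  then have "(\<lambda>j. (j * m) mod n) ` {..<n} = {..<n}"
    using n by (intro endo_inj_surj) auto
  moreover have "1 \<in> {..<n}" using n by simp
  ultimately obtain j where j: "j < n" "(j * m) mod n = 1" by (metis (mono_tags, lifting) imageE lessThan_iff)
  have j0: "j \<noteq> 0" using j by (intro notI) simp
  have yj: "y j = y 0 * cis (2 * \<epsilon> * \<delta>)"
    using y_constant_angle[OF a, of j] cis_eq[of j] j by simp
  \<comment> \<open>The intersection of the tangents at \<open>y 0\<close> and \<open>y j\<close>,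
    symmetric to both contact points; it is inside both sides because \<delta> < a.\<close>
  define p where "p = y 0 * (1 + \<i> * of_real (\<epsilon> * tan \<delta>))"
  have cos: "cos (\<epsilon> * \<delta>) \<noteq> 0" using eps \<delta> a01 cos_gt_zero[of \<delta>] by auto
  have t: "\<epsilon> * tan \<delta> = tan (\<epsilon> * \<delta>)" using eps by auto
  have p2: "p = y j * (1 + \<i> * of_real (- (\<epsilon> * tan \<delta>)))"
  proof -
    have "p = y 0 * (cis (\<epsilon> * \<delta>) / of_real (cos (\<epsilon> * \<delta>)))"
      unfolding p_def t using one_plus_i_tan[OF cos] by simp
    also have "cis (\<epsilon> * \<delta>) = cis (2 * \<epsilon> * \<delta>) * cis (- (\<epsilon> * \<delta>))" by (simp add: cis_mult algebra_simps)
    also have "y 0 * (cis (2 * \<epsilon> * \<delta>) * cis (- (\<epsilon> * \<delta>)) / of_real (cos (\<epsilon> * \<delta>)))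
        = y j * (cis (- (\<epsilon> * \<delta>)) / of_real (cos (- (\<epsilon> * \<delta>))))" by (simp add: yj)
    also have "\<dots> = y j * (1 + \<i> * of_real (tan (- (\<epsilon> * \<delta>))))"
      using one_plus_i_tan[of "- (\<epsilon> * \<delta>)"] cos by simp
    finally show ?thesis by (simp add: t)
  qed
  have tl: "0 < tan \<delta>" "tan \<delta> < tan a"
    using \<delta> a01 by (auto intro!: tan_gt_zero tan_monotone)
  then have ab: "\<bar>\<epsilon> * tan \<delta>\<bar> \<le> \<bar>\<epsilon> * tan a\<bar>" "\<epsilon> * tan a \<noteq> 0" using eps by auto
  have seg: "y i * (1 + \<i> * of_real t) \<in> closed_segment (klein (v i)) (klein (v (Suc i)))"
    if "\<bar>t\<bar> \<le> \<bar>\<epsilon> * tan a\<bar>" for i t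
    using closed_segment_tangent[OF that ab(2), of "y i"] klein_v[of i] klein_v_Suc[of i] by (simp add: a)
  have s0: "p \<in> closed_segment (klein (v 0)) (klein (v (Suc 0)))" unfolding p_def by (rule seg[OF ab(1)])
  have sj: "p \<in> closed_segment (klein (v j)) (klein (v (Suc j)))" unfolding p2 using ab(1) by (intro seg) simp
  have p1: "cmod p < 1"
    using s0 closed_segment_subset[of "klein (v 0)" hplane "klein (v (Suc 0))"] in_disc cmod_klein_less
    by (auto simp: convex_ball)
  let ?u = "klein_inv p"
  have "?u \<in> hsegment (v 0) (v (Suc 0)) \<inter> hsegment (v j) (v (Suc j))"
    using hsegment_iff_klein[OF in_disc in_disc klein_klein_inv(1)[OF p1]] klein_klein_inv(2)[OF p1] s0 sj
    by simp
  \<comment> \<open>Simplicity leaves only the ends of side 0, whose tangent parameter is tan a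
    instead of tan \<delta>.\<close>
  then have "?u = v 0 \<or> ?u = v (Suc 0)" using simple[of 0 j] j j0 n by blast
  then have "p = klein (v 0) \<or> p = klein (v (Suc 0))" using klein_klein_inv(2)[OF p1] by metis
  then have "1 + \<i> * of_real (\<epsilon> * tan \<delta>) = 1 - \<i> * of_real (\<epsilon> * tan a)
      \<or> 1 + \<i> * of_real (\<epsilon> * tan \<delta>) = 1 + \<i> * of_real (\<epsilon> * tan a)"
    unfolding klein_v[of 0] klein_v_Suc[of 0] p_def using y_neq_zero[of 0] by (simp add: a)
  then have "\<epsilon> * tan \<delta> = - (\<epsilon> * tan a) \<or> \<epsilon> * tan \<delta> = \<epsilon> * tan a"
    by (simp add: complex_eq_iff)
  then show False using eps tl by auto
qed

text \<open>
  Equal sides only force the half-angles to alternate between two values; then triangles formed by the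
  centre and two vertices at index distance 2 are isosceles with a common apex angle, and equal bases
  make them congruent.
\<close>

lemma regular_alpha:
  assumes side: "\<And>j. hdist (v j) (v (Suc j)) = s"
    and diag: "\<And>j. hdist (v j) (v (Suc (Suc j))) = d"
  shows "\<alpha> j = pi / real n"
proof -
  have lt: "\<bar>sinh r * tan (\<alpha> j)\<bar> < 1" for j
  proof -
    have "0 < tan (\<alpha> j)" by (intro tan_gt_zero alpha)
    then show ?thesis using alpha(3)[of j] r by (simp add: abs_mult)
  qed
  have tan_inj: "\<alpha> i = \<alpha> j" if "tan (\<alpha> i) = tan (\<alpha> j)" for i j
  proof -
    have "arctan (tan (\<alpha> k)) = \<alpha> k" for k using alpha(1,2)[of k] by (intro arctan_tan) linarith+
    then show ?thesis using that by metis
  qed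
  have two: "\<alpha> (Suc (Suc j)) = \<alpha> j" for j
  proof -
    have "artanh (sinh r * tan (\<alpha> (Suc (Suc j)))) = artanh (sinh r * tan (\<alpha> j))"
      using hdist_v[of j] hdist_v[of "Suc j"] side by simp
    then show ?thesis using artanh_real_inj[OF lt lt] sinh_r_pos tan_inj by simp
  qed
  define \<sigma> where "\<sigma> = \<alpha> 0 + \<alpha> (Suc 0)"
  have \<sigma>: "\<alpha> j + \<alpha> (Suc j) = \<sigma>" for j
    by (induction j) (simp_all add: \<sigma>_def two)
  have rot: "v (Suc (Suc j)) = v j * cis (2 * \<epsilon> * \<sigma>)" for j
  proof (rule v_rotation)
    have "y (Suc (Suc j)) = y j * cis (2 * \<epsilon> * \<sigma>)"
      unfolding y_Suc[of "Suc j"] y_Suc[of j] two[of j] \<sigma>[of j, symmetric] mult.assoc cis_mult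
      by (simp add: algebra_simps)
    then show "klein (v (Suc (Suc j))) = klein (v j) * cis (2 * \<epsilon> * \<sigma>)"
      by (simp add: klein_v two)
  qed
  define K where "K = (cmod (1 - cis (2 * \<epsilon> * \<sigma>)))\<^sup>2"
  \<comment> \<open>With a trivial rotation the base of the triangles would vanish and say nothing
    about their legs.\<close>
  have "cis (2 * \<epsilon> * \<sigma>) \<noteq> 1"
  proof
    assume "cis (2 * \<epsilon> * \<sigma>) = 1"
    then have "v 2 = v 0" using rot[of 0] by (simp add: numeral_2_eq_2)
    then show False using distinct[of 2 0] n by simp
  qed
  then have K: "K \<noteq> 0" by (auto simp: K_def)
  have eq: "(cmod (v i))\<^sup>2 = (cmod (v j))\<^sup>2" for i j
  proof -
    define p q where "p = (cmod (v i))\<^sup>2" and "q = (cmod (v j))\<^sup>2"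
    have pq: "0 < 1 - p" "0 < 1 - q" using one_minus_cmod_sq_pos[OF in_disc] by (simp_all add: p_def q_def)
    have c: "cosh d = 1 + 2 * ((cmod (v k))\<^sup>2 * K) / ((1 - (cmod (v k))\<^sup>2) * (1 - (cmod (v k))\<^sup>2))" for k
    proof -
      have "v k - v (Suc (Suc k)) = v k * (1 - cis (2 * \<epsilon> * \<sigma>))" by (simp add: rot algebra_simps)
      then have "(cmod (v k - v (Suc (Suc k))))\<^sup>2 = (cmod (v k))\<^sup>2 * K"
        by (simp add: norm_mult power_mult_distrib K_def)
      moreover have "cmod (v (Suc (Suc k))) = cmod (v k)" by (simp add: rot norm_mult)
      ultimately show ?thesis
        unfolding diag[of k, symmetric] cosh_hdist[OF in_disc in_disc] by simp
    qed
    have "p * K / ((1 - p) * (1 - p)) = q * K / ((1 - q) * (1 - q))"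
      using c[of i] c[of j] by (simp add: p_def[symmetric] q_def[symmetric])
    then have "p * ((1 - q) * (1 - q)) = q * ((1 - p) * (1 - p))"
      using K pq by (simp add: frac_eq_eq)
    \<comment> \<open>This is injectivity of x / (1 - x)^2 on [0, 1).\<close>
    then have "(p - q) * (1 - p * q) = 0" by (simp add: algebra_simps)
    moreover have "p * q < 1 * 1" using pq by (intro mult_strict_mono') (auto simp: p_def q_def)
    ultimately show ?thesis by (simp add: p_def q_def)
  qed
  have const: "\<alpha> i = \<alpha> 0" for i
  proof -
    have "cmod (v i) = cmod (v 0)" using eq[of i 0] by (simp add: power2_eq_iff_nonneg)
    then have "cmod (klein (v i)) = cmod (klein (v 0))" by (simp add: cmod_klein)
    then have "(cmod (1 - \<i> * of_real (\<epsilon> * tan (\<alpha> i))))\<^sup>2 = (cmod (1 - \<i> * of_real (\<epsilon> * tan (\<alpha> 0))))\<^sup>2"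
      using r by (simp add: klein_v norm_mult cmod_y)
    then have "(\<epsilon> * tan (\<alpha> i))\<^sup>2 = (\<epsilon> * tan (\<alpha> 0))\<^sup>2" unfolding cmod_power2 by simp
    then have "(tan (\<alpha> i))\<^sup>2 = (tan (\<alpha> 0))\<^sup>2" using eps by auto
    then have "tan (\<alpha> i) = tan (\<alpha> 0)"
      using tan_gt_zero[OF alpha(1,2)] by (simp add: power2_eq_iff_nonneg less_imp_le)
    then show ?thesis by (rule tan_inj)
  qed
  have "m = 1" by (rule winding_number_one[OF const])
  moreover have "(\<Sum>j<n. \<alpha> j) = (\<Sum>j<n. \<alpha> 0)" by (rule sum.cong[OF refl const])
  ultimately have "real n * \<alpha> 0 = pi" using alpha_sum by simp
  then show ?thesis using const[of j] n by (simp add: field_simps)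
qed

lemma perimeter_regular:
  assumes "\<And>j. \<alpha> j = pi / real n"
  shows "(\<Sum>j<n. hdist (v j) (v (Suc j))) = 2 * real n * artanh (tan (pi / real n) * sinh r)"
  by (simp add: perimeter_eq assms mult.commute)

text \<open>Rotating \<open>v 0\<close> to the positive real axis, and reflecting if \<epsilon> = -
  1, leaves a configuration determined by n and r, through which any two equality cases are
  compared.\<close>

lemma regular_normal_form:
  assumes a: "\<And>j. \<alpha> j = pi / real n"
  shows "\<exists>g. hisometry g \<and> (\<forall>j. g (v j) =
     of_real (regular_vertex_norm n r) * cis (2 * pi * real j / real n))"
proof -
  define \<rho> where "\<rho> = regular_vertex_norm n r"
  have "(cmod (klein (v 0)))\<^sup>2 = (cmod (of_real (tanh r) * (1 + \<i> * of_real (tan (pi / real n)))))\<^sup>2"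
    unfolding klein_v norm_mult power_mult_distrib cmod_y a using eps
    by (auto simp: cmod_power2)
  then have "cmod (klein (v 0)) = cmod (of_real (tanh r) * (1 + \<i> * of_real (tan (pi / real n))))"
    by (simp add: power2_eq_iff_nonneg)
  then have v0: "cmod (v 0) = \<rho>"
    unfolding \<rho>_def regular_vertex_norm_def by (metis cmod_klein_inv klein_inv_klein in_disc)
  then have \<rho>: "\<rho> \<noteq> 0" using v_neq_zero[of 0] by auto
  define w where "w = cnj (v 0) / of_real \<rho>"
  have w: "cmod w = 1" unfolding w_def v0[symmetric] using v_neq_zero[of 0] by (simp add: norm_divide)
  have wv: "w * v j = of_real \<rho> * cis (\<epsilon> * (2 * pi * real j / real n))" for j
  proof -
    have "w * v j = (v 0 * cnj (v 0)) / of_real \<rho> * cis (2 * \<epsilon> * real j * (pi / real n))"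
      unfolding v_constant_angle[OF a, of j] w_def by simp
    also have "v 0 * cnj (v 0) = of_real \<rho> * of_real \<rho>"
      using v0 complex_norm_square[of "v 0"] by (simp add: power2_eq_square)
    finally show ?thesis using \<rho> by (simp add: algebra_simps)
  qed
  show ?thesis
  proof (cases "\<epsilon> = 1")
    case True
    then show ?thesis using wv hisometry_rotation[OF w] unfolding \<rho>_def[symmetric]
      by (intro exI[of _ "\<lambda>z. w * z"]) simp
  next
    case False
    then have "\<epsilon> = - 1" using eps by simp
    then show ?thesis
      using wv hisometry_compose[OF hisometry_rotation[OF w] hisometry_cnj] unfolding \<rho>_def[symmetric]
      by (intro exI[of _ "cnj \<circ> (\<lambda>z. w * z)"]) (simp add: cis_cnj del: complex_cnj_mult, simp add: cis_cnj)
  qed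
qed

text \<open>With equal half-angles a rotation about the centre shifts the indices, and it cancels in
  the quotient, whose argument is the left angle.\<close>

lemma corner_ratio:
  assumes a: "\<And>j. \<alpha> j = a"
  shows "to_origin (v (Suc j)) (v j) / to_origin (v (Suc j)) (v (Suc (Suc j)))
    = to_origin (v (Suc 0)) (v 0) / to_origin (v (Suc 0)) (v (Suc (Suc 0)))"
proof -
  let ?w = "cis (2 * \<epsilon> * real j * a)"
  have v: "v (j + i) = ?w * v i" for i
    unfolding v_constant_angle[OF a, of "j + i"] v_constant_angle[OF a, of i]
    by (simp add: mult.left_commute cis_mult algebra_simps)
  show ?thesis
    using v[of 0] v[of "Suc 0"] v[of "Suc (Suc 0)"] by (simp add: to_origin_rotation)
qed

end

section \<open>From lists of vertices to coordinates\<close>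

lemma vertex_in_disc: "hpolygon n xs \<Longrightarrow> cmod (vertex xs j) < 1"
proof -
  assume h: "hpolygon n xs"
  then have "vertex xs j \<in> set xs" by (auto simp: hpolygon_def vertex_def intro!: nth_mem mod_less_divisor)
  then show ?thesis using h by (auto simp: hpolygon_def)
qed

lemma vertex_mod: "vertex xs (j mod length xs) = vertex xs j"
  by (simp add: vertex_def)

lemma vertex_Suc_mod: "vertex xs (Suc (j mod length xs)) = vertex xs (Suc j)"
  by (simp add: vertex_def mod_Suc_eq)

lemma vertex_Suc_Suc_mod: "vertex xs (Suc (Suc (j mod length xs))) = vertex xs (Suc (Suc j))"
  using mod_add_left_eq[of j "length xs" 2] by (simp add: vertex_def)

text \<open>An isometry moves the centre to 0. Tangency and the absence of straight corners are
  given for indices below n only and are transferred through \<open>j mod n\<close>.\<close>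

lemma tangential_polygonI:
  assumes h: "hpolygon n xs" and "tangential_with_inradius xs r"
  shows "\<exists>c. cmod c < 1 \<and> tangential_polygon n (\<lambda>j. to_origin c (vertex xs j)) r"
proof -
  obtain c where r: "0 < r" and c: "cmod c < 1" and side_t: "\<And>j. j < length xs \<Longrightarrow> side_tangent xs j c r"
    using assms by (auto simp: tangential_with_inradius_def)
  define f where "f = to_origin c"
  have f: "hisometry f" using hisometry_to_origin[OF c] by (simp add: f_def)
  have inj: "inj_on f hplane" using f by (simp add: hisometry_def bij_betw_def)
  have f0: "f c = 0" by (simp add: f_def to_origin_def)
  have n: "n \<ge> 3" "length xs = n" "distinct xs" using h by (auto simp: hpolygon_def)
  have len: "0 < length xs" using n by simp
  let ?v = "vertex xs"
  note d = vertex_in_disc[OF h]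
  have line: "hline (f (?v i)) (f (?v j)) = f ` hline (?v i) (?v j)" for i j
    using hisometry_hline[OF f d d] by simp
  have seg: "hsegment (f (?v i)) (f (?v j)) = f ` hsegment (?v i) (?v j)" for i j
    using hisometry_hsegment[OF f d d] by simp
  have sub: "hline z w \<subseteq> hplane" "hsegment z w \<subseteq> hplane" "hcircle z r \<subseteq> hplane" for z w
    by (auto simp: hline_def hsegment_def hcircle_def)
  have "tangential_polygon n (\<lambda>j. f (?v j)) r"
  proof
    show "n \<ge> 3" "0 < r" using n r by auto
    show "f (?v (j + n)) = f (?v j)" for j using n by (simp add: vertex_def)
    show "cmod (f (?v j)) < 1" for j by (rule hisometry_hplane[OF f d])
    show "i = j" if "i < n" "j < n" "f (?v i) = f (?v j)" for i j
    proof -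
      have "?v i = ?v j" using inj_onD[OF inj that(3)] d by simp
      then show ?thesis using that n by (simp add: vertex_def nth_eq_iff_index_eq)
    qed
    show "f (?v (Suc (Suc j))) \<notin> hline (f (?v j)) (f (?v (Suc j)))" for j
    proof
      assume "f (?v (Suc (Suc j))) \<in> hline (f (?v j)) (f (?v (Suc j)))"
      then have "?v (Suc (Suc j)) \<in> hline (?v j) (?v (Suc j))"
        unfolding line using inj_on_image_mem_iff[OF inj _ sub(1)] d by simp
      moreover have "?v (Suc (Suc (j mod n))) \<notin> hline (?v (j mod n)) (?v (Suc (j mod n)))"
        using h n by (simp add: hpolygon_def)
      ultimately show False by (simp add: n(2)[symmetric] vertex_mod vertex_Suc_mod vertex_Suc_Suc_mod)
    qed
    show "\<exists>t\<in>hsegment (f (?v j)) (f (?v (Suc j))).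
        hline (f (?v j)) (f (?v (Suc j))) \<inter> hcircle 0 r = {t}" for j
    proof -
      obtain t where t: "t \<in> hsegment (?v j) (?v (Suc j))" "hline (?v j) (?v (Suc j)) \<inter> hcircle c r = {t}"
        using side_t[of "j mod length xs"] len
        by (auto simp: side_tangent_def side_def vertex_mod vertex_Suc_mod)
      have "hline (f (?v j)) (f (?v (Suc j))) \<inter> hcircle 0 r = f ` (hline (?v j) (?v (Suc j)) \<inter> hcircle c r)"
        unfolding line inj_on_image_Int[OF inj sub(1) sub(3)] hisometry_hcircle[OF f c] f0 ..
      then show ?thesis unfolding seg t(2) using t(1) by auto
    qed
    show "hsegment (f (?v i)) (f (?v (Suc i))) \<inter> hsegment (f (?v j)) (f (?v (Suc j)))
        \<subseteq> {f (?v i), f (?v (Suc i))} \<inter> {f (?v j), f (?v (Suc j))}"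
      if "i < n" "j < n" "i \<noteq> j" for i j
    proof -
      have "hsegment (?v i) (?v (Suc i)) \<inter> hsegment (?v j) (?v (Suc j))
        \<subseteq> {?v i, ?v (Suc i)} \<inter> {?v j, ?v (Suc j)}"
        using h that unfolding hpolygon_def side_def by blast
      then have "f ` (hsegment (?v i) (?v (Suc i)) \<inter> hsegment (?v j) (?v (Suc j)))
        \<subseteq> f ` ({?v i, ?v (Suc i)} \<inter> {?v j, ?v (Suc j)})" by (rule image_mono)
      also have "\<dots> \<subseteq> {f (?v i), f (?v (Suc i))} \<inter> {f (?v j), f (?v (Suc j))}" by auto
      finally show ?thesis unfolding seg inj_on_image_Int[OF inj sub(2) sub(2)] .
    qed
  qed
  then show ?thesis using c unfolding f_def by blast
qed

section \<open>Perimeter as an invariant of the unlabelled set of sides\<close>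

lemma hsegment_endpoints:
  assumes "cmod z < 1" "cmod w < 1" "cmod z' < 1" "cmod w' < 1" and eq: "hsegment z w = hsegment z' w'"
  shows "{z, w} = {z', w'}"
proof -
  \<comment> \<open>In the Klein model the segments become Euclidean ones, which determine their end
    points.\<close>
  have img: "klein ` hsegment a b = closed_segment (klein a) (klein b)" if "cmod a < 1" "cmod b < 1" for a b
  proof (intro equalityI subsetI)
    fix x assume "x \<in> klein ` hsegment a b"
    then show "x \<in> closed_segment (klein a) (klein b)"
      using hsegment_iff_klein[OF that] by (auto simp: hsegment_def)
  next
    fix x assume x: "x \<in> closed_segment (klein a) (klein b)"
    moreover have "closed_segment (klein a) (klein b) \<subseteq> hplane"
      using that cmod_klein_less by (intro closed_segment_subset) auto
    ultimately have x1: "cmod x < 1" by auto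
    have "klein_inv x \<in> hsegment a b"
      using hsegment_iff_klein[OF that klein_klein_inv(1)[OF x1]] klein_klein_inv(2)[OF x1] x by simp
    then show "x \<in> klein ` hsegment a b" using klein_klein_inv(2)[OF x1] by force
  qed
  have "closed_segment (klein z) (klein w) = closed_segment (klein z') (klein w')"
    using img assms by metis
  then have "{klein z, klein w} = {klein z', klein w'}" by (simp add: closed_segment_eq)
  then have "klein_inv ` {klein z, klein w} = klein_inv ` {klein z', klein w'}" by simp
  then show ?thesis using assms by (simp add: klein_inv_klein)
qed

text \<open>The \<open>THE\<close> is well-defined on segments, because a segment determines its end points.\<close>

definition hlength :: "complex set \<Rightarrow> real" where
  "hlength S = (THE d. \<exists>z w. cmod z < 1 \<and> cmod w < 1 \<and> S = hsegment z w \<and> d = hdist z w)"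

lemma hlength_hsegment:
  assumes "cmod z < 1" "cmod w < 1"
  shows "hlength (hsegment z w) = hdist z w"
  unfolding hlength_def
proof (rule the_equality)
  fix d assume "\<exists>z' w'. cmod z' < 1 \<and> cmod w' < 1 \<and> hsegment z w = hsegment z' w' \<and> d = hdist z' w'"
  then obtain z' w' where a: "cmod z' < 1" "cmod w' < 1" "hsegment z w = hsegment z' w'" "d = hdist z' w'"
    by blast
  then have "{z, w} = {z', w'}" using hsegment_endpoints assms by blast
  then show "d = hdist z w" using a hdist_commute assms by (auto simp: doubleton_eq_iff)
qed (use assms in blast)

text \<open>A sum over the set \<open>sides xs\<close> must count every side once. As n is at least
  3, different sides have different pairs of end points.\<close>

lemma inj_on_side:
  assumes h: "hpolygon n xs"
  shows "inj_on (side xs) {..<length xs}"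
proof (rule inj_onI, rule ccontr)
  fix i j assume ij: "i \<in> {..<length xs}" "j \<in> {..<length xs}" "side xs i = side xs j" "i \<noteq> j"
  have n: "n \<ge> 3" "length xs = n" "distinct xs" using h by (auto simp: hpolygon_def)
  have "{vertex xs i, vertex xs (Suc i)} = {vertex xs j, vertex xs (Suc j)}"
    using ij(3) unfolding side_def by (intro hsegment_endpoints vertex_in_disc[OF h])
  moreover have "vertex xs a = vertex xs b \<longleftrightarrow> a mod n = b mod n" for a b
    using n by (simp add: vertex_def nth_eq_iff_index_eq)
  ultimately have "{i mod n, Suc i mod n} = {j mod n, Suc j mod n}"
    by (auto simp: doubleton_eq_iff)
  then show False using ij n by (auto simp: doubleton_eq_iff mod_Suc split: if_splits)
qed

lemma perimeter_eq_sum_hlength: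
  assumes h: "hpolygon n xs"
  shows "perimeter xs = (\<Sum>S\<in>sides xs. hlength S)"
  unfolding sides_def sum.reindex[OF inj_on_side[OF h]]
  by (simp add: perimeter_def side_def hlength_hsegment vertex_in_disc[OF h])

lemma side_subset: "side xs j \<subseteq> hplane"
  by (auto simp: side_def hsegment_def)

text \<open>The isometry matches sides without matching indices, so the perimeters are compared as
  sums of \<open>hlength\<close>.\<close>

lemma perimeter_isometric:
  assumes h: "hpolygon n xs" and h': "hpolygon n' ys" and iso: "isometric_polygons xs ys"
  shows "perimeter xs = perimeter ys"
proof -
  obtain f where f: "hisometry f" "image f ` sides xs = sides ys"
    using iso by (auto simp: isometric_polygons_def)
  have inj: "inj_on f hplane" using f by (simp add: hisometry_def bij_betw_def)
  have "inj_on (image f) (sides xs)"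
  proof (rule inj_onI)
    fix A B assume "A \<in> sides xs" "B \<in> sides xs" "f ` A = f ` B"
    moreover from this have "A \<subseteq> hplane" "B \<subseteq> hplane" using side_subset by (auto simp: sides_def)
    ultimately show "A = B" using inj_on_image_eq_iff[OF inj] by blast
  qed
  then have "perimeter ys = (\<Sum>S\<in>sides xs. hlength (f ` S))"
    unfolding perimeter_eq_sum_hlength[OF h'] f(2)[symmetric] by (simp add: sum.reindex)
  also have "\<dots> = (\<Sum>S\<in>sides xs. hlength S)"
  proof (rule sum.cong[OF refl])
    fix S assume "S \<in> sides xs"
    then obtain j where S: "S = hsegment (vertex xs j) (vertex xs (Suc j))" by (auto simp: sides_def side_def)
    show "hlength (f ` S) = hlength S"
      unfolding S hisometry_hsegment[OF f(1) vertex_in_disc[OF h] vertex_in_disc[OF h]]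
      by (simp add: hlength_hsegment hisometry_hdist[OF f(1)] hisometry_hplane[OF f(1)] vertex_in_disc[OF h])
  qed
  finally show ?thesis unfolding perimeter_eq_sum_hlength[OF h] ..
qed

lemma isometric_polygonsI:
  assumes h: "hpolygon n xs" and h': "hpolygon n ys" and f: "hisometry f"
    and v: "\<And>j. f (vertex xs j) = vertex ys j"
  shows "isometric_polygons xs ys"
proof -
  have "length xs = length ys" using h h' by (simp add: hpolygon_def)
  moreover have "f ` side xs j = side ys j" for j
    unfolding side_def hisometry_hsegment[OF f vertex_in_disc[OF h] vertex_in_disc[OF h]] v ..
  ultimately have "image f ` sides xs = sides ys" by (simp add: sides_def image_image)
  then show ?thesis using f by (auto simp: isometric_polygons_def)
qed

text \<open>The case distinction in \<open>interior_angle\<close> does not depend on the index, so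
  angles compare alike whichever side of the boundary is inside.\<close>

lemma interior_angle_eq_iff: "interior_angle xs i = interior_angle xs j \<longleftrightarrow> left_angle xs i = left_angle xs j"
  by (simp add: interior_angle_def)

lemma left_angle_mod: "left_angle xs (j mod length xs) = left_angle xs j"
  by (simp add: left_angle_def vertex_mod vertex_Suc_mod vertex_Suc_Suc_mod)

text \<open>By \<open>to_origin_to_origin\<close> all directions at b are multiplied by one common
  factor, which cancels; so angles may be computed after centring the incircle.\<close>

lemma to_origin_ratio_invariant:
  assumes "cmod c < 1" "cmod b < 1" "cmod a < 1" "cmod z < 1"
  shows "to_origin (to_origin c b) (to_origin c a) / to_origin (to_origin c b) (to_origin c z)
    = to_origin b a / to_origin b z"
proof -
  have "1 - cnj c * b \<noteq> 0" "1 - cnj b * c \<noteq> 0" using cmod_to_origin_sq(2) assms by blast+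
  then show ?thesis using assms by (simp add: to_origin_to_origin mult.commute)
qed

text \<open>The length of the diagonal is determined by two sides and the included angle.\<close>

lemma regular_diagonal:
  assumes Q: "regular_polygon n xs"
  shows "\<exists>d. \<forall>j. hdist (vertex xs j) (vertex xs (Suc (Suc j))) = d"
    and "\<exists>s. \<forall>j. hdist (vertex xs j) (vertex xs (Suc j)) = s"
proof -
  have h: "hpolygon n xs" and n: "n \<ge> 3" "length xs = n" using Q by (auto simp: regular_polygon_def hpolygon_def)
  then have n0: "j mod n < n" for j by simp
  note d = vertex_in_disc[OF h]
  let ?v = "vertex xs"
  define s where "s = hdist (?v 0) (?v (Suc 0))"
  have side: "hdist (?v j) (?v (Suc j)) = s" for j
  proof -
    have "hdist (?v (j mod n)) (?v (Suc (j mod n))) = hdist (?v (0 mod n)) (?v (Suc (0 mod n)))"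
      using Q n0[of j] n0[of 0] unfolding regular_polygon_def by blast
    then show ?thesis by (simp add: n(2)[symmetric] vertex_mod vertex_Suc_mod s_def)
  qed
  then show "\<exists>s. \<forall>j. hdist (?v j) (?v (Suc j)) = s" by blast
  define \<theta> where "\<theta> = left_angle xs 0"
  have angle: "left_angle xs j = \<theta>" for j
  proof -
    have "left_angle xs (j mod n) = left_angle xs (0 mod n)"
      using Q n0[of j] n0[of 0] unfolding regular_polygon_def interior_angle_eq_iff by blast
    then show ?thesis by (simp add: n(2)[symmetric] left_angle_mod \<theta>_def)
  qed
  define \<rho> where "\<rho> = tanh (s / 2)"
  have len: "cmod (to_origin z w) = \<rho>" if "hdist z w = s" "cmod z < 1" "cmod w < 1" for z w
    using that cmod_to_origin_less[of z w] by (auto simp: \<rho>_def hdist_def tanh_artanh_real)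
  have "cosh (hdist (?v j) (?v (Suc (Suc j)))) = 1 + 2 * (\<rho>\<^sup>2 * (cmod (cis \<theta> - 1))\<^sup>2) / ((1 - \<rho>\<^sup>2) * (1 - \<rho>\<^sup>2))" for j
  proof -
    let ?b = "?v (Suc j)"
    \<comment> \<open>With the corner moved to the origin, its two neighbours have equal modulus and
      differ by the rotation \<open>cis \<theta>\<close>.\<close>
    define A B where "A = to_origin ?b (?v j)" and "B = to_origin ?b (?v (Suc (Suc j)))"
    have lA: "cmod A = \<rho>" unfolding A_def using side hdist_commute d by (intro len) auto
    have lB: "cmod B = \<rho>" unfolding B_def using side d by (intro len) auto
    have "A = B * cis \<theta>"
    proof (cases "\<rho> = 0")
      case True
      then show ?thesis using lA lB by simp
    next
      case False
      then have "B \<noteq> 0" "cmod (A / B) = 1" using lA lB by (auto simp: norm_divide)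
      moreover have "Arg2pi (A / B) = \<theta>" using angle[of j] by (simp add: left_angle_def A_def B_def)
      ultimately have "A / B = cis \<theta>" using Arg2pi_eq[of "A / B"] by (simp add: cis_conv_exp)
      then show ?thesis using \<open>B \<noteq> 0\<close> by (simp add: field_simps)
    qed
    then have "A - B = B * (cis \<theta> - 1)" by (simp add: algebra_simps)
    then have "(cmod (A - B))\<^sup>2 = \<rho>\<^sup>2 * (cmod (cis \<theta> - 1))\<^sup>2" by (simp add: norm_mult power_mult_distrib lB)
    moreover have "hdist (?v j) (?v (Suc (Suc j))) = hdist A B"
      unfolding A_def B_def using hisometry_hdist[OF hisometry_to_origin[OF d] d d] by simp
    moreover have "cmod A < 1" "cmod B < 1" unfolding A_def B_def by (intro cmod_to_origin_less d)+
    ultimately show ?thesis by (simp add: cosh_hdist lA lB)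
  qed
  then have "hdist (?v j) (?v (Suc (Suc j))) = hdist (?v 0) (?v (Suc (Suc 0)))" for j
    by (intro hdist_eqI d) simp
  then show "\<exists>d. \<forall>j. hdist (?v j) (?v (Suc (Suc j))) = d" by blast
qed

section \<open>The perimeter of a single tangential polygon\<close>

lemma perimeter_coords:
  assumes h: "hpolygon n xs" and c: "cmod c < 1"
  shows "perimeter xs = (\<Sum>j<n. hdist (to_origin c (vertex xs j)) (to_origin c (vertex xs (Suc j))))"
  using h hisometry_hdist[OF hisometry_to_origin[OF c] vertex_in_disc[OF h] vertex_in_disc[OF h]]
  by (simp add: perimeter_def hpolygon_def)

lemma tangential_perimeter_bound:
  assumes h: "hpolygon n xs" and t: "tangential_with_inradius xs r"
  shows "tan (pi / real n) * sinh r < 1"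
    and "2 * real n * artanh (tan (pi / real n) * sinh r) \<le> perimeter xs"
proof -
  obtain c where c: "cmod c < 1" "tangential_polygon n (\<lambda>j. to_origin c (vertex xs j)) r"
    using tangential_polygonI[OF h t] by blast
  then obtain y \<alpha> \<epsilon> m where T: "tangential_polygon_coords n (\<lambda>j. to_origin c (vertex xs j)) r y \<alpha> \<epsilon> m"
    using tangential_polygon.coords_exist by blast
  show "tan (pi / real n) * sinh r < 1"
    "2 * real n * artanh (tan (pi / real n) * sinh r) \<le> perimeter xs"
    using tangential_polygon_coords.inradius_bound[OF T] tangential_polygon_coords.perimeter_ge[OF T]
    by (simp_all add: perimeter_coords[OF h c(1)])
qed

lemma regular_tangential_perimeter:
  assumes Q: "regular_polygon n xs" and t: "tangential_with_inradius xs r"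
  shows "perimeter xs = 2 * real n * artanh (tan (pi / real n) * sinh r)"
proof -
  have h: "hpolygon n xs" using Q by (simp add: regular_polygon_def)
  obtain c where c: "cmod c < 1" "tangential_polygon n (\<lambda>j. to_origin c (vertex xs j)) r"
    using tangential_polygonI[OF h t] by blast
  then obtain y \<alpha> \<epsilon> m where T: "tangential_polygon_coords n (\<lambda>j. to_origin c (vertex xs j)) r y \<alpha> \<epsilon> m"
    using tangential_polygon.coords_exist by blast
  obtain d s where ds: "\<And>j. hdist (vertex xs j) (vertex xs (Suc (Suc j))) = d"
    "\<And>j. hdist (vertex xs j) (vertex xs (Suc j)) = s"
    using regular_diagonal[OF Q] by blast
  note iso = hisometry_hdist[OF hisometry_to_origin[OF c(1)] vertex_in_disc[OF h] vertex_in_disc[OF h]]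
  have "\<alpha> j = pi / real n" for j
    by (rule tangential_polygon_coords.regular_alpha[OF T, of s d]) (simp_all add: iso ds)
  then show ?thesis
    using tangential_polygon_coords.perimeter_regular[OF T] by (simp add: perimeter_coords[OF h c(1)])
qed

lemma tangential_perimeter_equality:
  assumes h: "hpolygon n xs" and t: "tangential_with_inradius xs r"
    and eq: "perimeter xs = 2 * real n * artanh (tan (pi / real n) * sinh r)"
  shows "regular_polygon n xs"
    and "\<exists>g. hisometry g \<and> (\<forall>j. g (vertex xs j) =
     of_real (regular_vertex_norm n r) * cis (2 * pi * real j / real n))"
proof -
  obtain c where c: "cmod c < 1" "tangential_polygon n (\<lambda>j. to_origin c (vertex xs j)) r"
    using tangential_polygonI[OF h t] by blast
  then obtain y \<alpha> \<epsilon> m where T: "tangential_polygon_coords n (\<lambda>j. to_origin c (vertex xs j)) r y \<alpha> \<epsilon> m"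
    using tangential_polygon.coords_exist by blast
  note d = vertex_in_disc[OF h]
  have a: "\<alpha> j = pi / real n" for j
    by (rule tangential_polygon_coords.perimeter_equality[OF T])
      (simp add: perimeter_coords[OF h c(1), symmetric] eq)
  have "hdist (vertex xs j) (vertex xs (Suc j)) = 2 * artanh (sinh r * tan (pi / real n))" for j
    using tangential_polygon_coords.hdist_v[OF T, of j] hisometry_hdist[OF hisometry_to_origin[OF c(1)] d d]
    by (simp add: a)
  moreover have "left_angle xs i = left_angle xs j" for i j
    using tangential_polygon_coords.corner_ratio[OF T a, of i] tangential_polygon_coords.corner_ratio[OF T a, of j]
    unfolding left_angle_def to_origin_ratio_invariant[OF c(1) d d d] by simp
  ultimately show "regular_polygon n xs"
    using h unfolding regular_polygon_def interior_angle_eq_iff by simp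
  obtain g where g: "hisometry g" "\<And>j. g (to_origin c (vertex xs j)) =
     of_real (regular_vertex_norm n r) * cis (2 * pi * real j / real n)"
    using tangential_polygon_coords.regular_normal_form[OF T a] by blast
  then show "\<exists>g. hisometry g \<and> (\<forall>j. g (vertex xs j) =
     of_real (regular_vertex_norm n r) * cis (2 * pi * real j / real n))"
    using hisometry_compose[OF hisometry_to_origin[OF c(1)] g(1)]
    by (intro exI[of _ "g \<circ> to_origin c"]) simp
qed

theorem theorem1p7:
  fixes n k :: nat and P :: "nat \<Rightarrow> complex list" and r :: "nat \<Rightarrow> real" and T :: real
  assumes "n \<ge> 3" and "k \<ge> 1"
    and "\<And>i. i < k \<Longrightarrow> hpolygon n (P i)"
    and "\<And>i. i < k \<Longrightarrow> tangential_with_inradius (P i) (r i)"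
    and "(\<Sum>i<k. r i) = T"
  shows "(\<Sum>i<k. perimeter (P i))
            \<ge> 2 * real n * real k * artanh (tan (pi / real n) * sinh (T / real k)) \<and>
         ((\<Sum>i<k. perimeter (P i))
            = 2 * real n * real k * artanh (tan (pi / real n) * sinh (T / real k)) \<longleftrightarrow>
          (\<exists>Q. regular_polygon n Q \<and> tangential_with_inradius Q (T / real k) \<and>
               (\<forall>i<k. isometric_polygons (P i) Q)))"
proof -
  note h = assms(3) and t = assms(4)
  define \<tau> where "\<tau> = tan (pi / real n)"
  have "pi / real n < pi / 2" using assms(1) by (intro divide_strict_left_mono) auto
  then have \<tau>: "0 < \<tau>" unfolding \<tau>_def using assms(1) by (intro tan_gt_zero) auto
  define F where "F x = 2 * real n * artanh (\<tau> * sinh x)" for x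
  have dom: "0 < r i \<and> \<tau> * sinh (r i) < 1" if "i < k" for i
    using tangential_perimeter_bound(1)[OF h t, OF that that] t[OF that]
    by (simp add: \<tau>_def tangential_with_inradius_def)
  have bound: "F (r i) \<le> perimeter (P i)" if "i < k" for i
    using tangential_perimeter_bound(2)[OF h t, OF that that] by (simp add: \<tau>_def F_def)
  have jensen: "real k * F (T / real k) \<le> (\<Sum>i<k. F (r i))"
    using mult_left_mono[OF sum_artanh_sinh(1)[OF \<tau> assms(2) dom assms(5)], of "2 * real n"]
    by (simp add: F_def sum_distrib_left[symmetric] algebra_simps)
  have sum_bound: "(\<Sum>i<k. F (r i)) \<le> (\<Sum>i<k. perimeter (P i))"
    using bound by (intro sum_mono) simp
  have rhs: "2 * real n * real k * artanh (tan (pi / real n) * sinh (T / real k)) = real k * F (T / real k)"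
    by (simp add: F_def \<tau>_def)
  have "\<exists>Q. regular_polygon n Q \<and> tangential_with_inradius Q (T / real k) \<and> (\<forall>i<k. isometric_polygons (P i) Q)"
    if eq: "(\<Sum>i<k. perimeter (P i)) = real k * F (T / real k)"
  proof -
    \<comment> \<open>The sum of the \<open>F (r i)\<close> is squeezed between equal bounds, so
      equality holds in Jensen and, termwise, in \<open>bound\<close>.\<close>
    have sums: "(\<Sum>i<k. F (r i)) = real k * F (T / real k)" "(\<Sum>i<k. perimeter (P i) - F (r i)) = 0"
      using eq jensen sum_bound by (auto simp: sum_subtractf)
    have "2 * real n * (\<Sum>i<k. artanh (\<tau> * sinh (r i))) = 2 * real n * (real k * artanh (\<tau> * sinh (T / real k)))"
      using sums(1) by (simp add: F_def sum_distrib_left mult.left_commute)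
    then have "(\<Sum>i<k. artanh (\<tau> * sinh (r i))) = real k * artanh (\<tau> * sinh (T / real k))"
      using assms(1) by simp
    then have r: "r i = T / real k" if "i < k" for i
      using sum_artanh_sinh(2)[OF \<tau> assms(2) dom assms(5) _ that] by blast
    have "perimeter (P i) = F (T / real k)" if "i < k" for i
      using sum_nonneg_eq_0_iff[of "{..<k}" "\<lambda>i. perimeter (P i) - F (r i)"] sums(2) bound r that by auto
    then have per: "perimeter (P i) = 2 * real n * artanh (tan (pi / real n) * sinh (T / real k))" if "i < k" for i
      using that by (simp add: F_def \<tau>_def)
    have tan': "tangential_with_inradius (P i) (T / real k)" if "i < k" for i
      using t[OF that] r[OF that] by simp
    have k0: "0 < k" using assms(2) by simp
    obtain g where g: "\<And>i. i < k \<Longrightarrow> hisometry (g i)" "\<And>i j. i < k \<Longrightarrow> g i (vertex (P i) j) =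
      of_real (regular_vertex_norm n (T / real k))
        * cis (2 * pi * real j / real n)"
      using tangential_perimeter_equality(2)[OF h tan' per] by metis
    \<comment> \<open>All inradii are T / k, so all polygons share one normal form and
      \<open>P 0\<close> can serve as Q: apply \<open>g i\<close>, then the inverse of
      \<open>g 0\<close>.\<close>
    have "isometric_polygons (P i) (P 0)" if i: "i < k" for i
    proof (rule isometric_polygonsI[OF h[OF i] h[OF k0] hisometry_compose[OF g(1)[OF i] hisometry_inv[OF g(1)[OF k0]]]])
      fix j
      have "inj_on (g 0) hplane" using g(1)[OF k0] by (simp add: hisometry_def bij_betw_def)
      moreover have "g i (vertex (P i) j) = g 0 (vertex (P 0) j)" using g(2)[OF i] g(2)[OF k0] by simp
      ultimately show "(inv_into hplane (g 0) \<circ> g i) (vertex (P i) j) = vertex (P 0) j"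
        using vertex_in_disc[OF h[OF k0]] by (simp add: inv_into_f_f)
    qed
    then show ?thesis
      using tangential_perimeter_equality(1)[OF h tan' per] tan' k0 by blast
  qed
  moreover have "(\<Sum>i<k. perimeter (P i)) = real k * F (T / real k)"
    if Q: "regular_polygon n Q" "tangential_with_inradius Q (T / real k)" "\<forall>i<k. isometric_polygons (P i) Q" for Q
  proof -
    have "perimeter (P i) = F (T / real k)" if "i < k" for i
    proof -
      have "perimeter (P i) = perimeter Q"
        using Q that h by (intro perimeter_isometric[of n _ n]) (auto simp: regular_polygon_def)
      then show ?thesis using regular_tangential_perimeter[OF Q(1,2)] by (simp add: F_def \<tau>_def)
    qed
    then show ?thesis by simp
  qed
  ultimately have "(\<Sum>i<k. perimeter (P i)) = real k * F (T / real k) \<longleftrightarrow>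
      (\<exists>Q. regular_polygon n Q \<and> tangential_with_inradius Q (T / real k) \<and>
         (\<forall>i<k. isometric_polygons (P i) Q))"
    by (intro iffI) (assumption | elim exE conjE)+
  then show ?thesis unfolding rhs using order.trans[OF jensen sum_bound] by (rule conjI[rotated])
qed

end
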